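(* Let $X$ be a closed subspace of $\ell_1$ such that the pair $(X,\ell_1)$ has the extension property (EP). Then $\ell_1/X$ has the very strong Schur property.
   Context: Extension property: if $Z$ is a Banach space and $E$ is a closed subspace of $Z$, the pair $(E,Z)$ has the $\lambda$-extension property, $\lambda$-(EP), if for every compact Hausdorff space $K$, every bounded operator $T:E\to C(K)$ has a bounded extension $\tilde T:Z\to C(K)$ with $\|\tilde T\|\le\lambda\|T\|$. The pair $(E,Z)$ has (EP) if it has $\lambda$-(EP) for some $\lambda\ge 1$. Trees: let $\mathcal F\mathbb N$ be the set of all finite subsets of $\mathbb N$, partially ordered by: $a\le b$ iff, writing $a=\{n_1<\dots<n_k\}$ and $b=\{m_1<\dots<m_l\}$, we have $k\le l$ and $m_i=n_i$ for $1\le i\le k$ (i.e. $a$ is an initial segment of $b$). $b$ is a successor of $a$ if $a\le b$ and $|b|=|a|+1$; $a+$ denotes the collection of successors of $a$; for $a\neq\emptyset$, $a-$ is the unique predecessor of $a$. A full tree is a set $S\subset\mathcal F\mathbb N$ such that (1) $\emptyset\in S$; (2) each $a\in S$ has infinitely many successors in $S$; (3) if $\emptyset\ne a\in S$ then $a-\in S$. A branch of $S$ is a sequence $\beta=\{a_n\}_{n=0}^\infty$ in $S$ with $a_0=\emptyset$ and $a_{n+1}$ a successor of $a_n$ for all $n\ge0$. A tree-assignment in a vector space $V$ is a map $a\mapsto x_a\in V$ defined on a full tree $S$. Very strong Schur property: for $\delta>0$, a tree-assignment $(x_a)_{a\in S}$ in a Banach space $Y$ is $\delta$-separated if $\|x_b-x_{b'}\|\ge\delta$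 whenever $b\ne b'$ in $S$ satisfy $b,b'\in a+$ for some $a\in S$. $Y$ has the very strong Schur property if there is a constant $c>0$ such that whenever $(x_a)_{a\in S}$ is a $\delta$-separated bounded tree-assignment in $Y$, there are a branch $\beta$ of $S$ and $x^*\in B_{Y^*}$ (the closed unit ball of $Y^*$) with $|x^*(x_a)|\ge c\delta$ whenever $\emptyset\ne a\in\beta$. *)

theory Defs
  imports "HOL-Analysis.Analysis" "HOL-Library.Sublist"
begin

section \<open>The Banach space \<open>\<ell>\<^sub>1\<close>\<close>

typedef ell1 = "{x :: nat \<Rightarrow> real. summable (\<lambda>n. \<bar>x n\<bar>)}"
  morphisms ell1_coord Abs_ell1
  by (intro exI[of _ "\<lambda>_. 0"]) simp

setup_lifting type_definition_ell1

lemma summable_ell1: "summable (\<lambda>n. \<bar>ell1_coord x n\<bar>)"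
  using ell1_coord[of x] by simp

lemma ell1_eqI: "(\<And>n. ell1_coord x n = ell1_coord y n) \<Longrightarrow> x = y"
  by (simp add: ell1_coord_inject[symmetric] fun_eq_iff)

instantiation ell1 :: real_normed_vector
begin

lift_definition zero_ell1 :: ell1 is "\<lambda>_. 0" by simp

lift_definition plus_ell1 :: "ell1 \<Rightarrow> ell1 \<Rightarrow> ell1" is "\<lambda>x y n. x n + y n"
  subgoal for x y
    by (rule summable_comparison_test'[where N=0 and g="\<lambda>n. \<bar>x n\<bar> + \<bar>y n\<bar>"]) (auto intro: summable_add)
  done

lift_definition uminus_ell1 :: "ell1 \<Rightarrow> ell1" is "\<lambda>x n. - x n" by simp

lift_definition minus_ell1 :: "ell1 \<Rightarrow> ell1 \<Rightarrow> ell1" is "\<lambda>x y n. x n - y n"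
  subgoal for x y
    by (rule summable_comparison_test'[where N=0 and g="\<lambda>n. \<bar>x n\<bar> + \<bar>y n\<bar>"]) (auto intro: summable_add)
  done

lift_definition scaleR_ell1 :: "real \<Rightarrow> ell1 \<Rightarrow> ell1" is "\<lambda>r x n. r * x n"
  by (simp add: abs_mult summable_mult)

lift_definition norm_ell1 :: "ell1 \<Rightarrow> real" is "\<lambda>x. \<Sum>n. \<bar>x n\<bar>" .

definition sgn_ell1 :: "ell1 \<Rightarrow> ell1" where "sgn_ell1 x = inverse (norm x) *\<^sub>R x"

definition dist_ell1 :: "ell1 \<Rightarrow> ell1 \<Rightarrow> real" where "dist_ell1 x y = norm (x - y)"

definition uniformity_ell1 :: "(ell1 \<times> ell1) filter"
  where "uniformity_ell1 = (INF e\<in>{0 <..}. principal {(x, y). dist x y < e})"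

definition open_ell1 :: "ell1 set \<Rightarrow> bool"
  where "open_ell1 U \<longleftrightarrow> (\<forall>x\<in>U. eventually (\<lambda>(x', y). x' = x \<longrightarrow> y \<in> U) uniformity)"

instance
proof
  fix a b :: real and x y z :: ell1
  show "dist x y = norm (x - y)" by (rule dist_ell1_def)
  show "x + y + z = x + (y + z)" by transfer (simp add: add.assoc)
  show "x + y = y + x" by transfer (simp add: add.commute)
  show "0 + x = x" by transfer simp
  show "- x + x = 0" by transfer simp
  show "x - y = x + - y" by transfer simp
  show "a *\<^sub>R (x + y) = a *\<^sub>R x + a *\<^sub>R y" by transfer (simp add: distrib_left)
  show "(a + b) *\<^sub>R x = a *\<^sub>R x + b *\<^sub>R x" by transfer (simp add: distrib_right)
  show "a *\<^sub>R b *\<^sub>R x = (a * b) *\<^sub>R x" by transfer (simp add: mult.assoc)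
  show "1 *\<^sub>R x = x" by transfer simp
  show "sgn x = inverse (norm x) *\<^sub>R x" by (simp add: sgn_ell1_def)
  show "uniformity = (INF e\<in>{0 <..}. principal {(x, y :: ell1). dist x y < e})"
    by (rule uniformity_ell1_def)
  show "open U = (\<forall>x\<in>U. eventually (\<lambda>(x', y). x' = x \<longrightarrow> y \<in> U) uniformity)" for U :: "ell1 set"
    by (rule open_ell1_def)
  show "(norm x = 0) = (x = 0)"
    by transfer (auto simp: suminf_eq_zero_iff fun_eq_iff)
  show "norm (a *\<^sub>R x) = \<bar>a\<bar> * norm x"
    by transfer (simp add: abs_mult suminf_mult)
  show "norm (x + y) \<le> norm x + norm y"
  proof transfer
    fix x y :: "nat \<Rightarrow> real"
    assume s: "summable (\<lambda>n. \<bar>x n\<bar>)" "summable (\<lambda>n. \<bar>y n\<bar>)"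
    have "summable (\<lambda>n. \<bar>x n + y n\<bar>)"
      by (rule summable_comparison_test'[where N=0, OF summable_add[OF s]]) auto
    then have "(\<Sum>n. \<bar>x n + y n\<bar>) \<le> (\<Sum>n. \<bar>x n\<bar> + \<bar>y n\<bar>)"
      by (intro suminf_le summable_add s) auto
    then show "(\<Sum>n. \<bar>x n + y n\<bar>) \<le> (\<Sum>n. \<bar>x n\<bar>) + (\<Sum>n. \<bar>y n\<bar>)"
      by (simp add: suminf_add[OF s])
  qed
qed

end

lemma norm_ell1_eq: "norm x = (\<Sum>n. \<bar>ell1_coord x n\<bar>)"
  by (rule norm_ell1.rep_eq)

lemma sum_abs_le_norm_ell1: "(\<Sum>n<k. \<bar>ell1_coord x n\<bar>) \<le> norm x"
  unfolding norm_ell1_eq by (rule sum_le_suminf[OF summable_ell1]) auto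

lemma abs_coord_le_norm_ell1: "\<bar>ell1_coord x n\<bar> \<le> norm x"
proof -
  have "(\<Sum>n<n. \<bar>ell1_coord x n\<bar>) \<ge> 0" by (intro sum_nonneg) simp
  with sum_abs_le_norm_ell1[of x "Suc n"] show ?thesis
    unfolding sum.lessThan_Suc by linarith
qed

instance ell1 :: banach
proof
  fix X :: "nat \<Rightarrow> ell1"
  assume C: "Cauchy X"
  have coord: "Cauchy (\<lambda>m. ell1_coord (X m) n)" for n
  proof (rule CauchyI)
    fix e :: real assume "e > 0"
    then obtain M where M: "\<forall>m\<ge>M. \<forall>n\<ge>M. norm (X m - X n) < e"
      using CauchyD[OF C] by blast
    have "norm (ell1_coord (X i) n - ell1_coord (X j) n) < e" if "i \<ge> M" "j \<ge> M" for i j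
      using M that abs_coord_le_norm_ell1[of "X i - X j" n]
      by (auto simp: minus_ell1.rep_eq intro: le_less_trans)
    then show "\<exists>M. \<forall>i\<ge>M. \<forall>j\<ge>M. norm (ell1_coord (X i) n - ell1_coord (X j) n) < e" by blast
  qed
  define l where "l n = lim (\<lambda>m. ell1_coord (X m) n)" for n
  have lim: "(\<lambda>m. ell1_coord (X m) n) \<longlonglongrightarrow> l n" for n
    using coord[of n] unfolding l_def convergent_LIMSEQ_iff[symmetric] by (rule Cauchy_convergent)
  have key: "\<exists>M. \<forall>m\<ge>M. \<forall>k. (\<Sum>n<k. \<bar>l n - ell1_coord (X m) n\<bar>) \<le> e" if "e > 0" for e
  proof -
    obtain M where M: "\<forall>m\<ge>M. \<forall>n\<ge>M. norm (X m - X n) < e"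
      using CauchyD[OF C \<open>e > 0\<close>] by blast
    have "(\<Sum>n<k. \<bar>l n - ell1_coord (X m) n\<bar>) \<le> e" if "m \<ge> M" for m k
    proof (rule tendsto_upperbound)
      show "(\<lambda>j. \<Sum>n<k. \<bar>ell1_coord (X j) n - ell1_coord (X m) n\<bar>)
              \<longlonglongrightarrow> (\<Sum>n<k. \<bar>l n - ell1_coord (X m) n\<bar>)"
        by (intro tendsto_intros lim)
      have "(\<Sum>n<k. \<bar>ell1_coord (X j) n - ell1_coord (X m) n\<bar>) \<le> e" if "j \<ge> M" for j
      proof -
        have "norm (X j - X m) < e" using M \<open>m \<ge> M\<close> that by blast
        with sum_abs_le_norm_ell1[of "X j - X m" k] show ?thesis
          by (simp add: minus_ell1.rep_eq)
      qed
      then show "\<forall>\<^sub>F j in sequentially. (\<Sum>n<k. \<bar>ell1_coord (X j) n - ell1_coord (X m) n\<bar>) \<le> e"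
        by (auto simp: eventually_sequentially)
    qed simp
    then show ?thesis by blast
  qed
  have diff: "summable (\<lambda>n. \<bar>l n - ell1_coord (X m) n\<bar>)"
    if "\<forall>k. (\<Sum>n<k. \<bar>l n - ell1_coord (X m) n\<bar>) \<le> e" for m e
    using that by (intro summableI_nonneg_bounded[where x=e]) auto
  obtain M where "\<forall>m\<ge>M. \<forall>k. (\<Sum>n<k. \<bar>l n - ell1_coord (X m) n\<bar>) \<le> 1"
    using key[of 1] by auto
  then have "summable (\<lambda>n. \<bar>l n - ell1_coord (X M) n\<bar>)" by (intro diff[of _ 1]) auto
  from summable_add[OF this summable_ell1[of "X M"]] have "summable (\<lambda>n. \<bar>l n\<bar>)"
    by (rule summable_comparison_test'[where N=0]) auto
  then have L: "ell1_coord (Abs_ell1 l) = l" by (simp add: Abs_ell1_inverse)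
  have "X \<longlonglongrightarrow> Abs_ell1 l"
  proof (rule LIMSEQ_I)
    fix e :: real assume "e > 0"
    then obtain M where M: "\<forall>m\<ge>M. \<forall>k. (\<Sum>n<k. \<bar>l n - ell1_coord (X m) n\<bar>) \<le> e / 2"
      using key[of "e / 2"] by auto
    have "norm (X m - Abs_ell1 l) < e" if "m \<ge> M" for m
    proof -
      have "norm (Abs_ell1 l - X m) \<le> e / 2"
        unfolding norm_ell1_eq minus_ell1.rep_eq L
        using M that by (intro suminf_le_const diff[of _ "e / 2"]) auto
      then show ?thesis using \<open>e > 0\<close> by (simp add: norm_minus_commute)
    qed
    then show "\<exists>M. \<forall>m\<ge>M. norm (X m - Abs_ell1 l) < e" by blast
  qed
  then show "convergent X" by (auto simp: convergent_def)
qed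


section \<open>Normed spaces with explicit carrier\<close>

text \<open>The spaces \<open>C(K)\<close> and \<open>\<ell>\<^sub>1/X\<close> depend on terms, so they cannot be types. Scalars are real.\<close>

record 'v nspace =
  vcarrier :: "'v set"
  vadd :: "'v \<Rightarrow> 'v \<Rightarrow> 'v"
  vscale :: "real \<Rightarrow> 'v \<Rightarrow> 'v"
  vnorm :: "'v \<Rightarrow> real"

definition vdist :: "'v nspace \<Rightarrow> 'v \<Rightarrow> 'v \<Rightarrow> real"
  where "vdist V x y = vnorm V (vadd V x (vscale V (- 1) y))"

definition nspace_on :: "'z::real_normed_vector set \<Rightarrow> 'z nspace"
  where "nspace_on E = \<lparr>vcarrier = E, vadd = (+), vscale = (*\<^sub>R), vnorm = norm\<rparr>"

definition bounded_operator :: "'v nspace \<Rightarrow> 'w nspace \<Rightarrow> ('v \<Rightarrow> 'w) \<Rightarrow> bool"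
  where "bounded_operator V W T \<longleftrightarrow>
    (\<forall>x\<in>vcarrier V. T x \<in> vcarrier W) \<and>
    (\<forall>x\<in>vcarrier V. \<forall>y\<in>vcarrier V. T (vadd V x y) = vadd W (T x) (T y)) \<and>
    (\<forall>r. \<forall>x\<in>vcarrier V. T (vscale V r x) = vscale W r (T x)) \<and>
    (\<exists>M. \<forall>x\<in>vcarrier V. vnorm W (T x) \<le> M * vnorm V x)"

text \<open>As in the library's \<^const>\<open>onorm\<close>, the quotient is \<open>0\<close> at vectors of norm \<open>0\<close>.\<close>

definition operator_norm :: "'v nspace \<Rightarrow> 'w nspace \<Rightarrow> ('v \<Rightarrow> 'w) \<Rightarrow> real"
  where "operator_norm V W T = (SUP x\<in>vcarrier V. vnorm W (T x) / vnorm V x)"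

definition dual_ball :: "'v nspace \<Rightarrow> ('v \<Rightarrow> real) set"
  where "dual_ball V =
    {f. bounded_operator V (nspace_on UNIV) f \<and> operator_norm V (nspace_on UNIV) f \<le> 1}"


section \<open>Quotient spaces\<close>

definition coset :: "'z::real_normed_vector set \<Rightarrow> 'z \<Rightarrow> 'z set"
  where "coset X z = (\<lambda>x. z + x) ` X"

text \<open>In the scalar multiplication \<open>X\<close> is added so that \<open>0\<close> times a coset is \<open>X\<close> and not \<open>{0}\<close>.\<close>

definition quotient_nspace :: "'z::real_normed_vector set \<Rightarrow> 'z set nspace"
  where "quotient_nspace X =
    \<lparr>vcarrier = range (coset X),
     vadd = (\<lambda>A B. {a + b | a b. a \<in> A \<and> b \<in> B}),
     vscale = (\<lambda>r A. {r *\<^sub>R a + x | a x. a \<in> A \<and> x \<in> X}),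
     vnorm = (\<lambda>A. INF a\<in>A. norm a)\<rparr>"

lemma vadd_quotient_coset:
  assumes "subspace X"
  shows "vadd (quotient_nspace X) (coset X y) (coset X z) = coset X (y + z)"
proof -
  have "y + z + x \<in> {a + b | a b. a \<in> coset X y \<and> b \<in> coset X z}" if "x \<in> X" for x
  proof -
    have "y + z + x = (y + x) + (z + 0)" by simp
    moreover have "y + x \<in> coset X y" "z + 0 \<in> coset X z"
      using that subspace_0[OF assms] unfolding coset_def by blast+
    ultimately show ?thesis by blast
  qed
  moreover have "(y + a) + (z + b) \<in> coset X (y + z)" if "a \<in> X" "b \<in> X" for a b
  proof -
    have "(y + a) + (z + b) = (y + z) + (a + b)" by simp
    then show ?thesis using subspace_add[OF assms that] unfolding coset_def by blast
  qed
  ultimately show ?thesis by (auto simp: quotient_nspace_def coset_def)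
qed

lemma vscale_quotient_coset:
  assumes "subspace X"
  shows "vscale (quotient_nspace X) r (coset X z) = coset X (r *\<^sub>R z)"
proof -
  have "r *\<^sub>R z + x \<in> {r *\<^sub>R a + x | a x. a \<in> coset X z \<and> x \<in> X}" if "x \<in> X" for x
  proof -
    have "z + 0 \<in> coset X z"
      using subspace_0[OF assms] unfolding coset_def by blast
    then show ?thesis using that by force
  qed
  moreover have "r *\<^sub>R (z + a) + b \<in> coset X (r *\<^sub>R z)" if "a \<in> X" "b \<in> X" for a b
  proof -
    have "r *\<^sub>R (z + a) + b = r *\<^sub>R z + (r *\<^sub>R a + b)" by (simp add: algebra_simps)
    then show ?thesis
      using subspace_add[OF assms subspace_scale[OF assms that(1)] that(2)]
      unfolding coset_def by blast
  qed
  ultimately show ?thesis by (auto simp: quotient_nspace_def coset_def)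
qed

lemma vnorm_quotient_coset:
  assumes "subspace X"
  shows "vnorm (quotient_nspace X) (coset X z) = infdist z X"
proof -
  have "(\<lambda>x. norm (z + x)) ` X = dist z ` X"
  proof -
    have "uminus ` X = X"
      using subspace_neg[OF assms] by (force intro: image_eqI[where x="- _"])
    then have "(\<lambda>x. norm (z + x)) ` X = (\<lambda>x. norm (z + x)) ` uminus ` X" by simp
    also have "\<dots> = dist z ` X" by (simp add: image_image dist_norm)
    finally show ?thesis .
  qed
  moreover have "X \<noteq> {}" using subspace_0[OF assms] by blast
  ultimately show ?thesis
    by (simp add: quotient_nspace_def coset_def infdist_def image_image)
qed


section \<open>The extension property\<close>

text \<open>Elements of \<open>C(K)\<close> are continuous functions normalised to be \<^const>\<open>undefined\<close> off the
  space \<open>K\<close>; the \<open>0\<close> in the supremum only matters for the empty space.\<close>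

definition C_space :: "'k topology \<Rightarrow> ('k \<Rightarrow> real) nspace"
  where "C_space K =
    \<lparr>vcarrier = {f \<in> extensional (topspace K). continuous_map K euclideanreal f},
     vadd = (\<lambda>f g. restrict (\<lambda>k. f k + g k) (topspace K)),
     vscale = (\<lambda>r f. restrict (\<lambda>k. r * f k) (topspace K)),
     vnorm = (\<lambda>f. Sup (insert 0 ((\<lambda>k. \<bar>f k\<bar>) ` topspace K)))\<rparr>"

text \<open>The ambient space \<open>Z\<close> is the whole type \<open>'z\<close>, and \<open>E\<close> is meant to be a closed subspace.
  The first parameter fixes the type of the points of \<open>K\<close>.\<close>

definition lambda_EP_over :: "'k itself \<Rightarrow> real \<Rightarrow> 'z::banach set \<Rightarrow> bool"
  where "lambda_EP_over (_ :: 'k itself) lam E \<longleftrightarrow>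
    (\<forall>K :: 'k topology. compact_space K \<longrightarrow> Hausdorff_space K \<longrightarrow>
      (\<forall>T. bounded_operator (nspace_on E) (C_space K) T \<longrightarrow>
        (\<exists>T'. bounded_operator (nspace_on UNIV) (C_space K) T' \<and>
          (\<forall>x\<in>E. T' x = T x) \<and>
          operator_norm (nspace_on UNIV) (C_space K) T'
            \<le> lam * operator_norm (nspace_on E) (C_space K) T)))"

text \<open>One cannot quantify over types inside a formula. The points of \<open>K\<close> are taken from the type
  \<open>'z \<Rightarrow> real\<close>, which is no restriction: by lemma \<open>lambda_EP_all_compact\<close> below, the property then
  holds for the compact Hausdorff spaces over any type.\<close>

definition lambda_EP :: "real \<Rightarrow> 'z::banach set \<Rightarrow> bool"
  where "lambda_EP lam E \<longleftrightarrow> lambda_EP_over TYPE('z \<Rightarrow> real) lam E"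

definition has_EP :: "'z::banach set \<Rightarrow> bool"
  where "has_EP E \<longleftrightarrow> (\<exists>lam\<ge>1. lambda_EP lam E)"

lemma lambda_EP_all_compact:
  fixes E :: "'z::banach set"
  assumes EP: "lambda_EP lam E" and E: "subspace E"
  shows "lambda_EP_over TYPE('k) lam E"
  unfolding lambda_EP_over_def
proof (intro allI impI)
  fix K :: "'k topology" and T
  assume cK: "compact_space K" and "Hausdorff_space K"
    and T: "bounded_operator (nspace_on E) (C_space K) T"
  define \<psi> where "\<psi> k = (\<lambda>e. if e \<in> E then T e k else 0)" for k
  define L where "L = top_of_set (\<psi> ` topspace K)"
  have tL: "topspace L = \<psi> ` topspace K" by (simp add: L_def)
  have Tc: "continuous_map K euclideanreal (T e)" "T e \<in> extensional (topspace K)" if "e \<in> E" for e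
    using T that by (auto simp: bounded_operator_def nspace_on_def C_space_def)
  have "continuous_map K (product_topology (\<lambda>_. euclideanreal) UNIV) \<psi>"
    unfolding continuous_map_componentwise_UNIV
  proof
    fix e show "continuous_map K euclideanreal (\<lambda>k. \<psi> k e)"
      using Tc by (cases "e \<in> E") (auto simp: \<psi>_def)
  qed
  then have \<psi>: "continuous_map K euclidean \<psi>" by (simp add: euclidean_product_topology)
  then have \<psi>L: "continuous_map K L \<psi>"
    by (simp add: L_def continuous_map_in_subtopology)
  have "compactin euclidean (\<psi> ` topspace K)"
    using image_compactin[OF _ \<psi>] cK by (simp add: compact_space_def)
  then have cL: "compact_space L" by (simp add: L_def compact_space_subtopology)
  have "Hausdorff_space (product_topology (\<lambda>_ :: 'z. euclideanreal) UNIV)"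
    by (simp add: Hausdorff_space_product_topology)
  then have hL: "Hausdorff_space L"
    by (simp add: L_def Hausdorff_space_subtopology euclidean_product_topology)
  define U where "U e = restrict (\<lambda>\<phi>. \<phi> e) (topspace L)" for e :: 'z
  have normU: "vnorm (C_space L) (U e) = vnorm (C_space K) (T e)" if "e \<in> E" for e
    using that by (simp add: C_space_def tL U_def image_image \<psi>_def)
  have "continuous_map L euclideanreal (U e)" for e
  proof -
    have "continuous_on (topspace L) (\<lambda>\<phi>. \<phi> e)"
      by (intro continuous_on_product_coordinates continuous_on_subset[OF _ subset_UNIV])
    then have "continuous_on (topspace L) (U e)"
      by (rule continuous_on_eq) (simp add: U_def)
    then show ?thesis by (simp add: L_def)
  qed
  moreover have "U (x + y) = restrict (\<lambda>k. U x k + U y k) (topspace L)" if "x \<in> E" "y \<in> E" for x y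
  proof -
    have "T (x + y) k = T x k + T y k" if "k \<in> topspace K" for k
      using T \<open>x \<in> E\<close> \<open>y \<in> E\<close> that
      by (simp add: bounded_operator_def nspace_on_def C_space_def)
    then show ?thesis
      using that subspace_add[OF E] by (auto simp: U_def tL \<psi>_def restrict_def fun_eq_iff)
  qed
  moreover have "U (r *\<^sub>R x) = restrict (\<lambda>k. r * U x k) (topspace L)" if "x \<in> E" for x r
  proof -
    have "T (r *\<^sub>R x) k = r * T x k" if "k \<in> topspace K" for k
      using T \<open>x \<in> E\<close> that by (simp add: bounded_operator_def nspace_on_def C_space_def)
    then show ?thesis
      using that subspace_scale[OF E] by (auto simp: U_def tL \<psi>_def restrict_def fun_eq_iff)
  qed
  moreover have "U e \<in> extensional (topspace L)" for e by (simp add: U_def)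
  moreover have "\<exists>M. \<forall>x\<in>E. vnorm (C_space L) (U x) \<le> M * norm x"
    using T normU by (simp add: bounded_operator_def nspace_on_def)
  ultimately have "bounded_operator (nspace_on E) (C_space L) U"
    by (simp add: bounded_operator_def nspace_on_def C_space_def)
  with EP cL hL obtain S where
    S: "bounded_operator (nspace_on UNIV) (C_space L) S" "\<forall>x\<in>E. S x = U x"
      "operator_norm (nspace_on UNIV) (C_space L) S
        \<le> lam * operator_norm (nspace_on E) (C_space L) U"
    unfolding lambda_EP_def lambda_EP_over_def by blast
  define T' where "T' z = restrict (\<lambda>k. S z (\<psi> k)) (topspace K)" for z
  have normT': "vnorm (C_space K) (T' z) = vnorm (C_space L) (S z)" for z
    by (simp add: C_space_def tL T'_def image_image)
  have "continuous_map K euclideanreal (T' z)" for z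
  proof -
    have "continuous_map L euclideanreal (S z)"
      using S(1) by (simp add: bounded_operator_def nspace_on_def C_space_def)
    from continuous_map_compose[OF \<psi>L this] show ?thesis
      by (rule continuous_map_eq) (simp add: T'_def)
  qed
  moreover have "T' (x + y) = restrict (\<lambda>k. T' x k + T' y k) (topspace K)" for x y
    using S(1) by (auto simp: T'_def bounded_operator_def nspace_on_def C_space_def tL
        restrict_def fun_eq_iff)
  moreover have "T' (r *\<^sub>R x) = restrict (\<lambda>k. r * T' x k) (topspace K)" for x r
    using S(1) by (auto simp: T'_def bounded_operator_def nspace_on_def C_space_def tL
        restrict_def fun_eq_iff)
  moreover have "T' e \<in> extensional (topspace K)" for e by (simp add: T'_def)
  moreover have "\<exists>M. \<forall>x. vnorm (C_space K) (T' x) \<le> M * norm x"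
    using S(1) normT' by (simp add: bounded_operator_def nspace_on_def)
  ultimately have "bounded_operator (nspace_on UNIV) (C_space K) T'"
    by (simp add: bounded_operator_def nspace_on_def C_space_def)
  moreover have "T' x = T x" if "x \<in> E" for x
  proof
    show "T' x k = T x k" for k
      using S(2) Tc(2)[OF that] that
      by (cases "k \<in> topspace K") (auto simp: T'_def U_def tL \<psi>_def extensional_def)
  qed
  moreover have "operator_norm (nspace_on UNIV) (C_space K) T'
      \<le> lam * operator_norm (nspace_on E) (C_space K) T"
    using S(3) normT' normU by (simp add: operator_norm_def nspace_on_def)
  ultimately show "\<exists>T'. bounded_operator (nspace_on UNIV) (C_space K) T' \<and>
      (\<forall>x\<in>E. T' x = T x) \<and>
      operator_norm (nspace_on UNIV) (C_space K) T'
        \<le> lam * operator_norm (nspace_on E) (C_space K) T" by blast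
qed


section \<open>Trees of finite subsets of \<open>\<nat>\<close>\<close>

definition initial_segment :: "nat set \<Rightarrow> nat set \<Rightarrow> bool"
  where "initial_segment a b \<longleftrightarrow>
    finite a \<and> finite b \<and> prefix (sorted_list_of_set a) (sorted_list_of_set b)"

definition successors :: "nat set \<Rightarrow> nat set set"
  where "successors a = {b. initial_segment a b \<and> card b = card a + 1}"

definition predecessor :: "nat set \<Rightarrow> nat set"
  where "predecessor b = (THE a. b \<in> successors a)"

lemma successors_iff:
  assumes "finite b" "b \<noteq> {}"
  shows "b \<in> successors a \<longleftrightarrow> a = b - {Max b}"
proof -
  let ?s = "sorted_list_of_set"
  let ?c = "b - {Max b}"
  have "?s b = ?s ?c @ [Max b]"
  proof (rule sorted_distinct_set_unique)
    have "x \<le> Max b" if "x \<in> b" for x using that assms by simp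
    then show "sorted (?s ?c @ [Max b])" using assms by (auto simp: sorted_append)
    show "set (?s b) = set (?s ?c @ [Max b])"
    proof -
      have "set (?s ?c @ [Max b]) = insert (Max b) ?c" using assms(1) by simp
      also have "\<dots> = b" using Max_in[OF assms] by blast
      finally show ?thesis using assms(1) by simp
    qed
    show "distinct (?s ?c @ [Max b])" using assms by auto
  qed simp_all
  then have b: "prefix xs (?s b) \<and> length xs = length (?s ?c) \<longleftrightarrow> xs = ?s ?c" for xs
    by (metis append_eq_append_conv prefixE prefixI)
  have c: "card b = card ?c + 1"
    using card_Suc_Diff1[OF assms(1) Max_in[OF assms]] by linarith
  show ?thesis
  proof
    assume "b \<in> successors a"
    then have "finite a" "prefix (?s a) (?s b) \<and> length (?s a) = length (?s ?c)"
      using c by (auto simp: successors_def initial_segment_def)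
    then have "?s a = ?s ?c" "finite a" using b by blast+
    then show "a = ?c" 
      by (rule sorted_list_of_set_inject) (use assms(1) in blast)+
  next
    assume "a = ?c"
    moreover have "prefix (?s ?c) (?s b)" using b by blast
    ultimately show "b \<in> successors a"
      unfolding successors_def initial_segment_def using c assms(1) by blast
  qed
qed

lemma predecessor_eq: "finite b \<Longrightarrow> b \<noteq> {} \<Longrightarrow> predecessor b = b - {Max b}"
  by (simp add: predecessor_def successors_iff)

definition full_tree :: "nat set set \<Rightarrow> bool"
  where "full_tree S \<longleftrightarrow>
    (\<forall>a\<in>S. finite a) \<and>
    {} \<in> S \<and>
    (\<forall>a\<in>S. infinite (successors a \<inter> S)) \<and>
    (\<forall>a\<in>S. a \<noteq> {} \<longrightarrow> predecessor a \<in> S)"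

definition branch :: "nat set set \<Rightarrow> (nat \<Rightarrow> nat set) \<Rightarrow> bool"
  where "branch S \<beta> \<longleftrightarrow>
    range \<beta> \<subseteq> S \<and> \<beta> 0 = {} \<and> (\<forall>n. \<beta> (Suc n) \<in> successors (\<beta> n))"


section \<open>The very strong Schur property\<close>

definition tree_assignment :: "'v nspace \<Rightarrow> nat set set \<Rightarrow> (nat set \<Rightarrow> 'v) \<Rightarrow> bool"
  where "tree_assignment Y S x \<longleftrightarrow> full_tree S \<and> (\<forall>a\<in>S. x a \<in> vcarrier Y)"

definition tree_separated :: "'v nspace \<Rightarrow> nat set set \<Rightarrow> (nat set \<Rightarrow> 'v) \<Rightarrow> real \<Rightarrow> bool"
  where "tree_separated Y S x \<delta> \<longleftrightarrow>
    (\<forall>a\<in>S. \<forall>b\<in>S \<inter> successors a. \<forall>b'\<in>S \<inter> successors a.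
      b \<noteq> b' \<longrightarrow> vdist Y (x b) (x b') \<ge> \<delta>)"

definition tree_bounded :: "'v nspace \<Rightarrow> nat set set \<Rightarrow> (nat set \<Rightarrow> 'v) \<Rightarrow> bool"
  where "tree_bounded Y S x \<longleftrightarrow> (\<exists>M. \<forall>a\<in>S. vnorm Y (x a) \<le> M)"

definition very_strong_Schur :: "'v nspace \<Rightarrow> bool"
  where "very_strong_Schur Y \<longleftrightarrow>
    (\<exists>c>0. \<forall>\<delta>>0. \<forall>S x.
      tree_assignment Y S x \<longrightarrow> tree_separated Y S x \<delta> \<longrightarrow> tree_bounded Y S x \<longrightarrow>
      (\<exists>\<beta> f. branch S \<beta> \<and> f \<in> dual_ball Y \<and>
        (\<forall>a\<in>range \<beta>. a \<noteq> {} \<longrightarrow> \<bar>f (x a)\<bar> \<ge> c * \<delta>)))"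

end

theory Submission
  imports Defs
begin

text \<open>
  Let \<open>B\<close> be the closed unit ball of \<open>\<ell>\<^sub>\<infinity>\<close> with the topology of coordinatewise convergence, which on
  \<open>B\<close> is the weak* topology. The restrictions to \<open>X\<close> of the functionals in \<open>B\<close> form a compact space
  \<open>K\<close>. Extending the canonical operator \<open>X \<rightarrow> C(K)\<close> to \<open>\<ell>\<^sub>1\<close> gives, for \<open>\<eta> \<in> B\<close>, a functional \<open>\<Phi> \<eta>\<close> on
  \<open>\<ell>\<^sub>1\<close> of norm at most \<open>\<lambda>\<close> that agrees with \<open>\<eta>\<close> on \<open>X\<close>, depends only on the restriction of \<open>\<eta>\<close> to
  \<open>X\<close>, and is weak* continuous in \<open>\<eta>\<close> (\<open>EP_selection\<close>). Then \<open>\<Psi> \<eta> = \<eta> - \<Phi> \<eta>\<close> annihilates \<open>X\<close>, so it is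
  a functional on \<open>\<ell>\<^sub>1/X\<close> of norm at most \<open>1 + \<lambda>\<close>, it is weak* continuous in \<open>\<eta>\<close>, and
  \<open>\<Psi> (\<eta> + \<xi>) = \<Psi> \<eta> + \<xi>\<close> whenever \<open>\<xi>\<close> annihilates \<open>X\<close> (\<open>EP_annihilator_selection\<close>).

  Lift the tree-assignment to vectors \<open>u\<^sub>a\<close> of \<open>\<ell>\<^sub>1\<close>. A branch and a point of \<open>B\<close> are built together, one
  node at a time. Given \<open>\<eta> \<in> B\<close> and a node \<open>a\<close>, every weak* neighbourhood of \<open>\<eta>\<close> contains an
  \<open>\<eta>' \<in> B\<close> with \<open>\<bar>\<Psi> \<eta>' u\<^sub>b\<bar> \<ge> \<delta>/8\<close> for some successor \<open>b\<close> of \<open>a\<close> (\<open>nearby_large_value\<close>). Indeed,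
  infinitely many \<open>\<delta>\<close>-separated vectors of \<open>\<ell>\<^sub>1/X\<close> cannot all have representatives that are bounded on
  the first \<open>N\<close> coordinates and of small norm on the others (\<open>separated_imp_large_wnorm\<close>), so by the
  Hahn-Banach theorem some \<open>b\<close> and some \<open>\<xi> \<in> B\<close>, annihilating \<open>X\<close> and tiny on the
  first \<open>N\<close> coordinates, satisfy \<open>\<xi> u\<^sub>b \<ge> \<delta>/4\<close>. Truncate \<open>\<eta>\<close> to the first \<open>N\<close> coordinates and shrink it
  slightly to \<open>\<theta>\<close>; then \<open>\<theta>\<close> and \<open>\<theta> + \<xi>\<close> are both in \<open>B\<close> and weak* close to \<open>\<eta>\<close>, and as
  \<open>\<Psi> (\<theta> + \<xi>) - \<Psi> \<theta> = \<xi>\<close>, one of the two serves as \<open>\<eta>'\<close>. By weak* continuity the inequalities obtained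
  at earlier nodes persist, up to replacing \<open>\<delta>/8\<close> by \<open>\<delta>/9\<close>, and \<open>\<Psi>\<close> at a weak* cluster point of the
  sequence, divided by the bound for its norm, is the required functional.
\<close>

section \<open>Sublinear functionals and the Hahn-Banach theorem\<close>

text \<open>Subadditive and positively homogeneous functionals; negative values are allowed.\<close>

definition sublinear :: "('a::real_vector \<Rightarrow> real) \<Rightarrow> bool"
  where "sublinear p \<longleftrightarrow> (\<forall>x y. p (x + y) \<le> p x + p y) \<and> (\<forall>t\<ge>0. \<forall>x. p (t *\<^sub>R x) = t * p x)"

lemma sublinearI:
  assumes "\<And>x y. p (x + y) \<le> p x + p y" "\<And>t x. t > 0 \<Longrightarrow> p (t *\<^sub>R x) \<le> t * p x"
  shows "sublinear p"
proof -
  have pos: "p (t *\<^sub>R x) = t * p x" if "t > 0" for t x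
  proof (rule antisym)
    show "p (t *\<^sub>R x) \<le> t * p x" by (rule assms(2)[OF that])
    have "p (inverse t *\<^sub>R t *\<^sub>R x) \<le> inverse t * p (t *\<^sub>R x)"
      using that by (intro assms(2)) simp
    then show "t * p x \<le> p (t *\<^sub>R x)" using that by (simp add: field_simps)
  qed
  have "p 0 = 0" using pos[of 2 0] by simp
  then have "p (t *\<^sub>R x) = t * p x" if "t \<ge> 0" for t x
    using pos[of t x] that by (cases "t = 0") auto
  then show ?thesis using assms(1) by (simp add: sublinear_def)
qed

lemma sublinear_add: "sublinear p \<Longrightarrow> p (x + y) \<le> p x + p y"
  and sublinear_scale: "sublinear p \<Longrightarrow> t \<ge> 0 \<Longrightarrow> p (t *\<^sub>R x) = t * p x"
  by (auto simp: sublinear_def)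

lemma sublinear_minus:
  assumes "sublinear p" shows "- p (- x) \<le> p x"
proof -
  have "p (0 *\<^sub>R x) = 0 * p x" using assms by (intro sublinear_scale) auto
  with sublinear_add[OF assms, of x "- x"] show ?thesis by simp
qed

text \<open>A sublinear functional can be lowered so that it becomes linear on the line through \<open>y\<close>, with the same
  value at \<open>y\<close>, by passing to the infimum over \<open>t \<ge> 0\<close> of \<open>p (x + t *\<^sub>R y) - t * p y\<close>.\<close>

lemma sublinear_linear_along:
  assumes p: "sublinear p"
  shows "\<exists>q. sublinear q \<and> (\<forall>x. q x \<le> p x) \<and> q (- y) \<le> - p y"
proof -
  define h where "h x t = p (x + t *\<^sub>R y) - t * p y" for x t
  define q where "q x = (INF t\<in>{0..}. h x t)" for x
  have low: "- p (- x) \<le> h x t" if "t \<ge> 0" for x t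
    using sublinear_add[OF p, of "x + t *\<^sub>R y" "- x"] sublinear_scale[OF p that, of y]
    by (simp add: h_def)
  have bdd: "bdd_below (h x ` {0..})" for x
    using low by (intro bdd_belowI2[where m = "- p (- x)"]) auto
  have le: "q x \<le> h x t" if "t \<ge> 0" for x t
    unfolding q_def using that by (intro cINF_lower bdd) auto
  have ge: "c \<le> q x" if "\<And>t. t \<ge> 0 \<Longrightarrow> c \<le> h x t" for c x
    unfolding q_def using that by (intro cINF_greatest) auto
  have "sublinear q"
  proof (rule sublinearI)
    fix x z
    have "q (x + z) - h x s \<le> h z t" if "s \<ge> 0" "t \<ge> 0" for s t
    proof -
      have "q (x + z) \<le> h (x + z) (s + t)" using that by (intro le) auto
      also have "\<dots> \<le> h x s + h z t"
        using sublinear_add[OF p, of "x + s *\<^sub>R y" "z + t *\<^sub>R y"]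
        by (simp add: h_def algebra_simps)
      finally show ?thesis by simp
    qed
    then have "q (x + z) - h x s \<le> q z" if "s \<ge> 0" for s
      using that by (intro ge) auto
    then have "q (x + z) - q z \<le> q x" by (intro ge) (auto simp: algebra_simps)
    then show "q (x + z) \<le> q x + q z" by simp
  next
    fix t :: real and x assume t: "t > 0"
    have "q (t *\<^sub>R x) / t \<le> q x"
    proof (rule ge)
      fix s :: real assume s: "s \<ge> 0"
      have "q (t *\<^sub>R x) \<le> h (t *\<^sub>R x) (t * s)" using s t by (intro le) auto
      also have "\<dots> = t * h x s"
        using sublinear_scale[OF p, of t "x + s *\<^sub>R y"] t by (simp add: h_def algebra_simps)
      finally show "q (t *\<^sub>R x) / t \<le> h x s" using t by (simp add: field_simps)
    qed
    then show "q (t *\<^sub>R x) \<le> t * q x" using t by (simp add: field_simps)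
  qed
  moreover have "q x \<le> p x" for x using le[of 0 x] by (simp add: h_def)
  moreover have "q (- y) \<le> - p y"
    using le[of 1 "- y"] sublinear_scale[OF p, of 0 0] by (simp add: h_def)
  ultimately show ?thesis by blast
qed

text \<open>By Zorn's lemma there is a minimal sublinear functional below \<open>p\<close>; it is linear, since lowering it
  along any line does not change it.\<close>

theorem Hahn_Banach_sublinear:
  fixes p :: "'a::real_vector \<Rightarrow> real"
  assumes p: "sublinear p"
  shows "\<exists>f. linear f \<and> (\<forall>x. f x \<le> p x) \<and> f u = p u"
proof -
  \<comment> \<open>Lowering \<open>p\<close> along \<open>u\<close> first forces every linear functional below \<open>p0\<close> to take the value \<open>p u\<close> at \<open>u\<close>.\<close>
  obtain p0 where p0: "sublinear p0" "\<And>x. p0 x \<le> p x" "p0 (- u) \<le> - p u"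
    using sublinear_linear_along[OF p, of u] by blast
  define A where "A = {q. sublinear q \<and> q \<le> p0}"
  have "\<exists>m\<in>A. \<forall>a\<in>A. m \<ge> a \<longrightarrow> a = m"
  proof (rule predicate_Zorn)
    show "partial_order_on A (relation_of (\<ge>) A)"
      by (rule partial_order_on_relation_ofI) auto
    fix C assume C: "C \<in> Chains (relation_of (\<ge>) A)"
    show "\<exists>u\<in>A. \<forall>a\<in>C. a \<ge> u"
    proof (cases "C = {}")
      case True
      have "p0 \<in> A" using p0(1) by (simp add: A_def)
      with True show ?thesis by blast
    next
      case False
      define q where "q x = (INF a\<in>C. a x)" for x
      have CA: "sublinear a" "a \<le> p0" if "a \<in> C" for a
        using that C by (auto simp: Chains_def relation_of_def A_def)
      have total: "a \<le> b \<or> b \<le> a" if "a \<in> C" "b \<in> C" for a b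
        using that C by (auto simp: Chains_def relation_of_def)
      have "- p0 (- x) \<le> a x" if "a \<in> C" for a x
      proof -
        have "- p0 (- x) \<le> - a (- x)" using CA(2)[OF that] by (simp add: le_fun_def)
        also have "\<dots> \<le> a x" by (rule sublinear_minus[OF CA(1)[OF that]])
        finally show ?thesis .
      qed
      then have bdd: "bdd_below ((\<lambda>a. a x) ` C)" for x
        by (intro bdd_belowI2[where m = "- p0 (- x)"]) auto
      have le: "q x \<le> a x" if "a \<in> C" for a x
        unfolding q_def using that by (intro cINF_lower bdd)
      have ge: "c \<le> q x" if "\<And>a. a \<in> C \<Longrightarrow> c \<le> a x" for c x
        unfolding q_def using that False by (intro cINF_greatest) auto
      have "sublinear q"
      proof (rule sublinearI)
        fix x z
        have "q (x + z) - a x \<le> b z" if ab: "a \<in> C" "b \<in> C" for a b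
        proof -
          obtain c where c: "c \<in> C" "c \<le> a" "c \<le> b" using total[OF ab] ab by blast
          have "q (x + z) \<le> c (x + z)" by (rule le[OF c(1)])
          also have "\<dots> \<le> c x + c z" by (rule sublinear_add[OF CA(1)[OF c(1)]])
          also have "\<dots> \<le> a x + b z" using c by (intro add_mono) (auto simp: le_fun_def)
          finally show ?thesis by simp
        qed
        then have "q (x + z) - a x \<le> q z" if "a \<in> C" for a
          using that by (intro ge) auto
        then have "q (x + z) - q z \<le> q x" by (intro ge) (auto simp: algebra_simps)
        then show "q (x + z) \<le> q x + q z" by simp
      next
        fix t :: real and x assume t: "t > 0"
        have "q (t *\<^sub>R x) / t \<le> q x"
        proof (rule ge)
          fix a assume a: "a \<in> C"
          have "q (t *\<^sub>R x) \<le> t * a x"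
            using le[OF a, of "t *\<^sub>R x"] sublinear_scale[OF CA(1)[OF a], of t x] t by simp
          then show "q (t *\<^sub>R x) / t \<le> a x" using t by (simp add: field_simps)
        qed
        then show "q (t *\<^sub>R x) \<le> t * q x" using t by (simp add: field_simps)
      qed
      moreover have "q \<le> p0"
      proof -
        obtain a where "a \<in> C" using False by blast
        with le[of a] CA(2)[of a] show ?thesis by (auto simp: le_fun_def intro: order_trans)
      qed
      ultimately show ?thesis using le by (intro bexI[of _ q]) (auto simp: A_def le_fun_def)
    qed
  qed
  then obtain m where m: "sublinear m" "m \<le> p0"
    and min: "\<And>a. sublinear a \<Longrightarrow> a \<le> m \<Longrightarrow> a = m"
    unfolding A_def by (auto dest: order_trans)
  have odd: "m (- y) = - m y" for y
  proof -
    obtain q where q: "sublinear q" "\<And>x. q x \<le> m x" "q (- y) \<le> - m y"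
      using sublinear_linear_along[OF m(1), of y] by blast
    have "q = m" using q by (intro min) (auto simp: le_fun_def)
    then show ?thesis using q(3) sublinear_minus[OF m(1), of y] by simp
  qed
  have "linear m"
  proof (rule linearI)
    fix x y
    have "m (- x + - y) \<le> m (- x) + m (- y)" by (rule sublinear_add[OF m(1)])
    moreover have "m (- x + - y) = - m (x + y)" using odd[of "x + y"] by simp
    ultimately show "m (x + y) = m x + m y"
      using sublinear_add[OF m(1), of x y] by (simp add: odd)
  next
    fix t :: real and x
    show "m (t *\<^sub>R x) = t *\<^sub>R m x"
      using sublinear_scale[OF m(1), of t x] sublinear_scale[OF m(1), of "- t" x] odd[of "t *\<^sub>R x"]
      by (cases "t \<ge> 0") auto
  qed
  moreover have mp: "m x \<le> p x" for x
    using m(2) p0(2)[of x] by (auto simp: le_fun_def intro: order_trans)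
  moreover have "m u = p u"
  proof (rule antisym)
    have "m (- u) \<le> - p u" using m(2) p0(3) by (auto simp: le_fun_def intro: order_trans)
    then show "p u \<le> m u" by (simp add: odd)
  qed (rule mp)
  ultimately show ?thesis by blast
qed

section \<open>Bounded sequences as functionals on \<open>\<ell>\<^sub>1\<close>\<close>

lemma tendsto_funI:
  fixes f :: "'b \<Rightarrow> 'i \<Rightarrow> 'a::topological_space"
  assumes "\<And>i. ((\<lambda>n. f n i) \<longlongrightarrow> l i) F"
  shows "(f \<longlongrightarrow> l) F"
proof -
  have "limitin (product_topology (\<lambda>_. euclidean) UNIV) f l F"
    unfolding limitin_componentwise using assms by simp
  then show ?thesis by (simp add: euclidean_product_topology)
qed

lemma tendsto_funD:
  fixes f :: "'b \<Rightarrow> 'i \<Rightarrow> 'a::topological_space"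
  assumes "(f \<longlongrightarrow> l) F"
  shows "((\<lambda>n. f n i) \<longlongrightarrow> l i) F"
  using continuous_on_tendsto_compose[OF continuous_on_product_coordinates assms] by simp

text \<open>The closed ball of radius \<open>C\<close> in \<open>\<ell>\<^sub>\<infinity>\<close>. It is a set of functions, so its topology is that of
  coordinatewise convergence, which is the weak* topology of \<open>\<ell>\<^sub>\<infinity> = \<ell>\<^sub>1\<^sup>*\<close> on this ball.\<close>

definition linf_ball :: "real \<Rightarrow> (nat \<Rightarrow> real) set"
  where "linf_ball C = {\<eta>. \<forall>i. \<bar>\<eta> i\<bar> \<le> C}"

lemma compact_linf_ball: "compact (linf_ball C)"
proof -
  have "linf_ball C = PiE UNIV (\<lambda>_. {- C..C})"
    by (rule set_eqI) (simp add: linf_ball_def PiE_UNIV_domain Pi_iff abs_le_iff, smt (verit))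
  moreover have "compactin (product_topology (\<lambda>_ :: nat. euclideanreal) UNIV) (PiE UNIV (\<lambda>_. {- C..C}))"
    by (subst compactin_PiE) simp
  ultimately show ?thesis by (simp add: euclidean_product_topology)
qed

lemma linf_ball_convergent_subseq:
  fixes v :: "nat \<Rightarrow> nat \<Rightarrow> real"
  assumes "\<And>n. v n \<in> linf_ball C"
  obtains l r where "l \<in> linf_ball C" "strict_mono r" "(v \<circ> r) \<longlonglongrightarrow> l"
  using compact_linf_ball[of C] assms unfolding compact_def by blast

text \<open>The duality between \<open>\<ell>\<^sub>\<infinity>\<close> and \<open>\<ell>\<^sub>1\<close>; meaningful when \<open>\<eta>\<close> is bounded.\<close>

definition pairing :: "(nat \<Rightarrow> real) \<Rightarrow> ell1 \<Rightarrow> real"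
  where "pairing \<eta> z = (\<Sum>i. \<eta> i * ell1_coord z i)"

text \<open>The weighted \<open>\<ell>\<^sub>1\<close>-norm with weights \<open>w\<close>, used for \<open>0 \<le> w i \<le> 1\<close>. The functionals bounded by it
  are those given by sequences \<open>\<eta>\<close> with \<open>\<bar>\<eta> i\<bar> \<le> w i\<close>.\<close>

definition wnorm :: "(nat \<Rightarrow> real) \<Rightarrow> ell1 \<Rightarrow> real"
  where "wnorm w z = (\<Sum>i. w i * \<bar>ell1_coord z i\<bar>)"

lemma summable_pairing:
  assumes "\<eta> \<in> linf_ball C"
  shows "summable (\<lambda>i. \<bar>\<eta> i * ell1_coord z i\<bar>)" "summable (\<lambda>i. \<eta> i * ell1_coord z i)"
proof -
  show "summable (\<lambda>i. \<bar>\<eta> i * ell1_coord z i\<bar>)"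
    using assms
    by (intro summable_comparison_test'[where N = 0, OF summable_mult[OF summable_ell1[of z], of C]])
      (auto simp: abs_mult linf_ball_def intro: mult_right_mono)
  then show "summable (\<lambda>i. \<eta> i * ell1_coord z i)" by (rule summable_rabs_cancel)
qed

lemma summable_wnorm:
  assumes "w \<in> linf_ball 1" shows "summable (\<lambda>i. w i * \<bar>ell1_coord z i\<bar>)"
  using summable_pairing(1)[OF assms, of z]
  by (intro summable_rabs_cancel[where f = "\<lambda>i. w i * \<bar>ell1_coord z i\<bar>"]) (simp add: abs_mult)

lemma linear_pairing:
  assumes "\<eta> \<in> linf_ball C" shows "linear (pairing \<eta>)"
proof (rule linearI)
  fix x y
  show "pairing \<eta> (x + y) = pairing \<eta> x + pairing \<eta> y"
    unfolding pairing_def plus_ell1.rep_eq distrib_left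
    by (rule suminf_add[symmetric]) (rule summable_pairing[OF assms])+
next
  fix r x
  show "pairing \<eta> (r *\<^sub>R x) = r *\<^sub>R pairing \<eta> x"
    unfolding pairing_def scaleR_ell1.rep_eq
    using suminf_mult[OF summable_pairing(2)[OF assms, of x], of r]
    by (simp add: mult.left_commute)
qed

lemma pairing_add:
  assumes "\<eta> \<in> linf_ball C" "\<xi> \<in> linf_ball D"
  shows "pairing (\<lambda>i. \<eta> i + \<xi> i) z = pairing \<eta> z + pairing \<xi> z"
  unfolding pairing_def distrib_right
  by (intro suminf_add[symmetric] summable_pairing(2)[OF assms(1)] summable_pairing(2)[OF assms(2)])

lemma abs_pairing_le:
  assumes "\<eta> \<in> linf_ball C" shows "\<bar>pairing \<eta> z\<bar> \<le> C * norm z"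
proof -
  have "\<bar>pairing \<eta> z\<bar> \<le> (\<Sum>i. \<bar>\<eta> i * ell1_coord z i\<bar>)"
    unfolding pairing_def by (rule summable_rabs[OF summable_pairing(1)[OF assms]])
  also have "\<dots> \<le> (\<Sum>i. C * \<bar>ell1_coord z i\<bar>)"
    using assms by (intro suminf_le summable_pairing(1)[OF assms] summable_mult summable_ell1)
      (auto simp: linf_ball_def abs_mult intro: mult_right_mono)
  also have "\<dots> = C * norm z"
    unfolding norm_ell1_eq by (rule suminf_mult[OF summable_ell1])
  finally show ?thesis .
qed

lemma continuous_on_pairing: "continuous_on (linf_ball 1) (\<lambda>\<eta>. pairing \<eta> z)"
proof -
  have "uniform_limit (linf_ball 1) (\<lambda>n \<eta>. \<Sum>i<n. \<eta> i * ell1_coord z i) (\<lambda>\<eta>. pairing \<eta> z) sequentially"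
    unfolding pairing_def
    by (rule Weierstrass_m_test[OF _ summable_ell1[of z]])
      (auto simp: linf_ball_def abs_mult intro: mult_left_le_one_le)
  moreover have "continuous_on (linf_ball 1) (\<lambda>\<eta>. \<Sum>i<n. \<eta> i * ell1_coord z i)" for n
    by (intro continuous_on_sum continuous_on_mult_right
        continuous_on_subset[OF continuous_on_product_coordinates] subset_UNIV)
  ultimately show ?thesis
    by (intro uniform_limit_theorem[where F = sequentially]) simp_all
qed

lemma sublinear_wnorm:
  assumes w: "w \<in> linf_ball 1" "\<And>i. w i \<ge> 0" shows "sublinear (wnorm w)"
proof (rule sublinearI)
  fix x y
  have "w i * \<bar>ell1_coord (x + y) i\<bar> \<le> w i * \<bar>ell1_coord x i\<bar> + w i * \<bar>ell1_coord y i\<bar>" for i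
    unfolding plus_ell1.rep_eq distrib_left[symmetric] by (intro mult_left_mono abs_triangle_ineq w)
  then have "wnorm w (x + y) \<le> (\<Sum>i. w i * \<bar>ell1_coord x i\<bar> + w i * \<bar>ell1_coord y i\<bar>)"
    unfolding wnorm_def by (intro suminf_le summable_add summable_wnorm w)
  also have "\<dots> = wnorm w x + wnorm w y"
    unfolding wnorm_def by (intro suminf_add[symmetric] summable_wnorm w)
  finally show "wnorm w (x + y) \<le> wnorm w x + wnorm w y" .
next
  fix t :: real and x assume "t > 0"
  then show "wnorm w (t *\<^sub>R x) \<le> t * wnorm w x"
    unfolding wnorm_def scaleR_ell1.rep_eq
    using suminf_mult[OF summable_wnorm[OF w(1), of x], of t] by (simp add: abs_mult mult.left_commute)
qed

lemma wnorm_nonneg: "w \<in> linf_ball 1 \<Longrightarrow> (\<And>i. w i \<ge> 0) \<Longrightarrow> wnorm w z \<ge> 0"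
  unfolding wnorm_def by (intro suminf_nonneg summable_wnorm) auto

lemma wnorm_minus: "wnorm w (- z) = wnorm w z"
  by (simp add: wnorm_def uminus_ell1.rep_eq)

lemma wnorm_le_norm:
  assumes "w \<in> linf_ball 1" shows "wnorm w z \<le> norm z"
proof -
  have "w i * \<bar>ell1_coord z i\<bar> \<le> \<bar>ell1_coord z i\<bar>" for i
    using mult_right_mono[of "w i" 1 "\<bar>ell1_coord z i\<bar>"] assms by (simp add: linf_ball_def abs_le_iff)
  then show ?thesis
    unfolding wnorm_def norm_ell1_eq
    by (intro suminf_le summable_wnorm summable_ell1 assms)
qed

text \<open>The unit vectors of \<open>\<ell>\<^sub>1\<close>.\<close>

lift_definition ell1_unit :: "nat \<Rightarrow> ell1" is "\<lambda>i j. if j = i then 1 else 0"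
proof -
  fix i :: nat
  show "summable (\<lambda>j. \<bar>if j = i then 1 else 0 :: real\<bar>)"
    by (rule summable_finite[of "{i}"]) auto
qed

lemma coord_sum: "ell1_coord (\<Sum>i\<in>I. f i) j = (\<Sum>i\<in>I. ell1_coord (f i) j)"
  by (induction I rule: infinite_finite_induct) (simp_all add: zero_ell1.rep_eq plus_ell1.rep_eq)

lemma ell1_unit_sums: "(\<lambda>i. ell1_coord z i *\<^sub>R ell1_unit i) sums z"
proof -
  have c: "ell1_coord (z - (\<Sum>i<n. ell1_coord z i *\<^sub>R ell1_unit i)) j = (if j < n then 0 else ell1_coord z j)" for n j
    by (simp add: minus_ell1.rep_eq coord_sum scaleR_ell1.rep_eq ell1_unit.rep_eq if_distrib sum.delta cong: if_cong)
  have tail: "norm (z - (\<Sum>i<n. ell1_coord z i *\<^sub>R ell1_unit i)) = norm z - (\<Sum>i<n. \<bar>ell1_coord z i\<bar>)" for n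
  proof -
    have "norm (z - (\<Sum>i<n. ell1_coord z i *\<^sub>R ell1_unit i)) = (\<Sum>j. \<bar>if j < n then 0 else ell1_coord z j\<bar>)"
      unfolding norm_ell1_eq c ..
    also have "\<dots> = (\<Sum>j. \<bar>ell1_coord z j\<bar> - (if j \<in> {..<n} then \<bar>ell1_coord z j\<bar> else 0))"
      by (intro suminf_cong) auto
    also have "\<dots> = norm z - (\<Sum>j. if j \<in> {..<n} then \<bar>ell1_coord z j\<bar> else 0)"
      unfolding norm_ell1_eq by (rule suminf_diff[symmetric]) (auto intro: summable_ell1 summable_finite[of "{..<n}"])
    also have "(\<Sum>j. if j \<in> {..<n} then \<bar>ell1_coord z j\<bar> else 0) = (\<Sum>j<n. \<bar>ell1_coord z j\<bar>)"
      by (subst suminf_finite[of "{..<n}"]) auto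
    finally show ?thesis .
  qed
  have "(\<lambda>n. norm z - (\<Sum>i<n. \<bar>ell1_coord z i\<bar>)) \<longlonglongrightarrow> norm z - norm z"
    unfolding norm_ell1_eq by (intro tendsto_intros summable_LIMSEQ summable_ell1)
  then have "(\<lambda>n. norm (z - (\<Sum>i<n. ell1_coord z i *\<^sub>R ell1_unit i))) \<longlonglongrightarrow> 0" by (simp add: tail)
  then have "(\<lambda>n. z - (\<Sum>i<n. ell1_coord z i *\<^sub>R ell1_unit i)) \<longlonglongrightarrow> 0" by (rule tendsto_norm_zero_cancel)
  from tendsto_diff[OF tendsto_const[of z] this] show ?thesis by (simp add: sums_def)
qed

lemma linear_eq_pairing:
  assumes g: "linear g" "\<And>z. \<bar>g z\<bar> \<le> norm z"
  shows "g z = pairing (\<lambda>i. g (ell1_unit i)) z"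
proof -
  have "bounded_linear g"
    using g by (intro bounded_linear_intro[where K = 1]) (auto simp: linear_add linear_scale)
  from bounded_linear.sums[OF this ell1_unit_sums[of z]]
  have "(\<lambda>i. ell1_coord z i * g (ell1_unit i)) sums g z" by (simp add: linear_scale[OF g(1)])
  then show ?thesis by (simp add: pairing_def sums_iff mult.commute)
qed

text \<open>The distance to \<open>X\<close> in the weighted norm is attained by a functional that annihilates \<open>X\<close> and whose
  coordinates are bounded by the weights: apply the Hahn-Banach theorem to this distance, which is
  sublinear.\<close>

lemma annihilator_attaining:
  assumes X: "subspace X" and w: "w \<in> linf_ball 1" "\<And>i. w i \<ge> 0"
  obtains \<xi> where "\<And>i. \<bar>\<xi> i\<bar> \<le> w i" "\<And>x. x \<in> X \<Longrightarrow> pairing \<xi> x = 0"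
    "pairing \<xi> u = (INF x\<in>X. wnorm w (u - x))"
proof -
  define p where "p u = (INF x\<in>X. wnorm w (u - x))" for u
  have bdd: "bdd_below ((\<lambda>x. wnorm w (u - x)) ` X)" for u
    by (intro bdd_belowI2[where m = 0] wnorm_nonneg w)
  have le: "p u \<le> wnorm w (u - x)" if "x \<in> X" for u x
    unfolding p_def using that by (intro cINF_lower bdd)
  have ge: "c \<le> p u" if "\<And>x. x \<in> X \<Longrightarrow> c \<le> wnorm w (u - x)" for c u
    unfolding p_def using that subspace_0[OF X] by (intro cINF_greatest) auto
  have "sublinear p"
  proof (rule sublinearI)
    fix u v
    have "p (u + v) - wnorm w (u - x) \<le> wnorm w (v - y)" if "x \<in> X" "y \<in> X" for x y
    proof -
      have "p (u + v) \<le> wnorm w (u + v - (x + y))" by (intro le subspace_add X that)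
      also have "u + v - (x + y) = (u - x) + (v - y)" by simp
      also have "wnorm w \<dots> \<le> wnorm w (u - x) + wnorm w (v - y)"
        by (rule sublinear_add[OF sublinear_wnorm[OF w]])
      finally show ?thesis by simp
    qed
    then have "p (u + v) - wnorm w (u - x) \<le> p v" if "x \<in> X" for x
      using that by (intro ge) auto
    then have "p (u + v) - p v \<le> p u" by (intro ge) (auto simp: algebra_simps)
    then show "p (u + v) \<le> p u + p v" by simp
  next
    fix t :: real and u assume t: "t > 0"
    have "p (t *\<^sub>R u) / t \<le> p u"
    proof (rule ge)
      fix x assume "x \<in> X"
      then have "p (t *\<^sub>R u) \<le> wnorm w (t *\<^sub>R u - t *\<^sub>R x)" by (intro le subspace_scale X)
      also have "\<dots> = t * wnorm w (u - x)"
        using sublinear_scale[OF sublinear_wnorm[OF w], of t "u - x"] t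
        by (simp add: scaleR_diff_right)
      finally show "p (t *\<^sub>R u) / t \<le> wnorm w (u - x)" using t by (simp add: field_simps)
    qed
    then show "p (t *\<^sub>R u) \<le> t * p u" using t by (simp add: field_simps)
  qed
  then obtain g where g: "linear g" "\<And>z. g z \<le> p z" "g u = p u"
    using Hahn_Banach_sublinear by blast
  have gw: "\<bar>g z\<bar> \<le> wnorm w z" for z
  proof -
    have "g z \<le> wnorm w z" for z using g(2)[of z] le[OF subspace_0[OF X], of z] by simp
    from this[of z] this[of "- z"] show ?thesis by (simp add: linear_neg[OF g(1)] wnorm_minus)
  qed
  have "\<bar>g z\<bar> \<le> norm z" for z using gw[of z] wnorm_le_norm[OF w(1), of z] by simp
  note rep = linear_eq_pairing[OF g(1) this]
  have w0: "wnorm w 0 = 0" by (simp add: wnorm_def zero_ell1.rep_eq)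
  show thesis
  proof (rule that[of "\<lambda>i. g (ell1_unit i)"])
    fix i
    have "wnorm w (ell1_unit i) = w i"
      unfolding wnorm_def ell1_unit.rep_eq by (subst suminf_finite[of "{i}"]) auto
    then show "\<bar>g (ell1_unit i)\<bar> \<le> w i" using gw[of "ell1_unit i"] by simp
  next
    fix x assume x: "x \<in> X"
    have "g x \<le> 0" "g (- x) \<le> 0"
      using g(2)[of x] le[OF x, of x] g(2)[of "- x"] le[OF subspace_neg[OF X x], of "- x"] w0 by auto
    then have "g x = 0" by (simp add: linear_neg[OF g(1)])
    then show "pairing (\<lambda>i. g (ell1_unit i)) x = 0" by (simp flip: rep)
  next
    show "pairing (\<lambda>i. g (ell1_unit i)) u = (INF x\<in>X. wnorm w (u - x))"
      using g(3) by (simp add: p_def flip: rep)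
  qed
qed

section \<open>Separated families modulo a subspace\<close>

lemma norm_ell1_split: "norm z = (\<Sum>i<N. \<bar>ell1_coord z i\<bar>) + (\<Sum>i. \<bar>ell1_coord z (i + N)\<bar>)"
  unfolding norm_ell1_eq using suminf_split_initial_segment[OF summable_ell1[of z], of N] by simp

lemma coord_lt_of_wnorm_lt:
  assumes "wnorm (\<lambda>i. if i < N then \<epsilon> else 1) z < r" "0 < \<epsilon>" "\<epsilon> \<le> 1"
  shows "(\<Sum>i. \<bar>ell1_coord z (i + N)\<bar>) < r" "i < N \<Longrightarrow> \<bar>ell1_coord z i\<bar> < r / \<epsilon>"
proof -
  let ?w = "\<lambda>i. if i < N then \<epsilon> else 1"
  have w: "?w \<in> linf_ball 1" using assms by (auto simp: linf_ball_def)
  have eq: "wnorm ?w z = (\<Sum>i. \<bar>ell1_coord z (i + N)\<bar>) + (\<Sum>i<N. \<epsilon> * \<bar>ell1_coord z i\<bar>)"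
    unfolding wnorm_def using suminf_split_initial_segment[OF summable_wnorm[OF w, of z], of N] by simp
  have s: "summable (\<lambda>i. \<bar>ell1_coord z (i + N)\<bar>)"
    using summable_ell1[of z] by (rule summable_ignore_initial_segment)
  have "(\<Sum>i<N. \<epsilon> * \<bar>ell1_coord z i\<bar>) \<ge> 0" using assms(2) by (intro sum_nonneg) auto
  then show "(\<Sum>i. \<bar>ell1_coord z (i + N)\<bar>) < r" using eq assms(1) by linarith
  show "\<bar>ell1_coord z i\<bar> < r / \<epsilon>" if "i < N"
  proof -
    have "\<epsilon> * \<bar>ell1_coord z i\<bar> \<le> (\<Sum>i<N. \<epsilon> * \<bar>ell1_coord z i\<bar>)"
      using that assms(2) by (intro member_le_sum) auto
    moreover have "(\<Sum>i. \<bar>ell1_coord z (i + N)\<bar>) \<ge> 0" by (intro suminf_nonneg s) auto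
    ultimately have "\<epsilon> * \<bar>ell1_coord z i\<bar> < r" using eq assms(1) by linarith
    then show ?thesis using assms(2) by (simp add: field_simps)
  qed
qed

text \<open>With small weights on the first \<open>N\<close> coordinates, a family that is \<open>\<delta>\<close>-separated modulo \<open>X\<close> cannot be
  uniformly close to \<open>X\<close> in the weighted norm. Otherwise its members are, modulo \<open>X\<close>, small off the first
  \<open>N\<close> coordinates and bounded on them, and by compactness two of them are close on these coordinates.\<close>

lemma separated_imp_large_wnorm:
  assumes X: "subspace X" and B: "infinite B" and \<delta>: "\<delta> > 0"
    and sep: "\<And>b b'. b \<in> B \<Longrightarrow> b' \<in> B \<Longrightarrow> b \<noteq> b' \<Longrightarrow> infdist (u b - u b') X \<ge> \<delta>"
    and \<epsilon>: "0 < \<epsilon>" "\<epsilon> \<le> 1"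
  shows "\<exists>b\<in>B. (INF x\<in>X. wnorm (\<lambda>i. if i < N then \<epsilon> else 1) (u b - x)) \<ge> \<delta> / 4"
proof (rule ccontr)
  let ?w = "\<lambda>i. if i < N then \<epsilon> else (1::real)"
  have w: "?w \<in> linf_ball 1" "\<And>i. ?w i \<ge> 0" using \<epsilon> by (auto simp: linf_ball_def)
  assume neg: "\<not> (\<exists>b\<in>B. (INF x\<in>X. wnorm ?w (u b - x)) \<ge> \<delta> / 4)"
  have "\<exists>x\<in>X. wnorm ?w (u b - x) < \<delta> / 4" if "b \<in> B" for b
  proof -
    have "X \<noteq> {}" using subspace_0[OF X] by blast
    moreover have "bdd_below ((\<lambda>x. wnorm ?w (u b - x)) ` X)"
      by (intro bdd_belowI2[where m = 0] wnorm_nonneg w)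
    ultimately show ?thesis
      using neg that cINF_less_iff[of X "\<lambda>x. wnorm ?w (u b - x)" "\<delta> / 4"] by (auto simp: not_le)
  qed
  then obtain x where x: "\<And>b. b \<in> B \<Longrightarrow> x b \<in> X" "\<And>b. b \<in> B \<Longrightarrow> wnorm ?w (u b - x b) < \<delta> / 4"
    by metis
  obtain e :: "nat \<Rightarrow> _" where e: "inj e" "range e \<subseteq> B"
    using infinite_countable_subset[OF B] by blast
  define z where "z n = u (e n) - x (e n)" for n
  have wz: "wnorm ?w (z n) < \<delta> / 4" for n unfolding z_def using e(2) by (intro x(2)) auto
  note zb = coord_lt_of_wnorm_lt[OF wz \<epsilon>]
  define v where "v n i = (if i < N then ell1_coord (z n) i else 0)" for n i
  have vb: "v n \<in> linf_ball (\<delta> / 4 / \<epsilon>)" for n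
    using zb(2)[of _ n] \<delta> \<epsilon> by (auto simp: linf_ball_def v_def less_imp_le)
  obtain l r where r: "strict_mono r" and "(v \<circ> r) \<longlonglongrightarrow> l"
    using linf_ball_convergent_subseq[of v, OF vb] by blast
  then have "(\<lambda>n. v (r n) i) \<longlonglongrightarrow> l i" for i
    using tendsto_funD[of "v \<circ> r" l sequentially i] by simp
  then have "(\<lambda>n. \<Sum>i<N. \<bar>v (r (Suc n)) i - v (r n) i\<bar>) \<longlonglongrightarrow> (\<Sum>i<N. \<bar>l i - l i\<bar>)"
    by (intro tendsto_intros LIMSEQ_Suc)
  then have "\<forall>\<^sub>F n in sequentially. (\<Sum>i<N. \<bar>v (r (Suc n)) i - v (r n) i\<bar>) < \<delta> / 2"
    using \<delta> by (intro order_tendstoD(2)[where a = "\<delta> / 2"]) auto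
  then obtain n where n: "(\<Sum>i<N. \<bar>v (r (Suc n)) i - v (r n) i\<bar>) < \<delta> / 2"
    by (auto simp: eventually_sequentially)
  define b b' where "b = e (r (Suc n))" and "b' = e (r n)"
  have bB: "b \<in> B" "b' \<in> B" using e(2) by (auto simp: b_def b'_def)
  have "r (Suc n) \<noteq> r n" using strict_monoD[OF r, of n "Suc n"] by simp
  then have "b \<noteq> b'" using e(1) by (auto simp: b_def b'_def dest: injD)
  then have "\<delta> \<le> infdist (u b - u b') X" using bB by (intro sep)
  also have "\<dots> \<le> dist (u b - u b') (x b - x b')"
    by (intro infdist_le subspace_diff X x(1) bB)
  also have "\<dots> = norm (z (r (Suc n)) - z (r n))"
    by (simp add: dist_norm z_def b_def b'_def algebra_simps)
  also have "\<dots> = (\<Sum>i<N. \<bar>ell1_coord (z (r (Suc n)) - z (r n)) i\<bar>)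
      + (\<Sum>i. \<bar>ell1_coord (z (r (Suc n)) - z (r n)) (i + N)\<bar>)" by (rule norm_ell1_split)
  also have "(\<Sum>i<N. \<bar>ell1_coord (z (r (Suc n)) - z (r n)) i\<bar>) = (\<Sum>i<N. \<bar>v (r (Suc n)) i - v (r n) i\<bar>)"
    by (intro sum.cong) (auto simp: v_def minus_ell1.rep_eq)
  also have "(\<Sum>i. \<bar>ell1_coord (z (r (Suc n)) - z (r n)) (i + N)\<bar>)
      \<le> (\<Sum>i. \<bar>ell1_coord (z (r (Suc n))) (i + N)\<bar> + \<bar>ell1_coord (z (r n)) (i + N)\<bar>)"
    by (intro suminf_le summable_add summable_ignore_initial_segment summable_ell1)
      (simp add: minus_ell1.rep_eq abs_triangle_ineq4)
  also have "\<dots> = (\<Sum>i. \<bar>ell1_coord (z (r (Suc n))) (i + N)\<bar>) + (\<Sum>i. \<bar>ell1_coord (z (r n)) (i + N)\<bar>)"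
    by (intro suminf_add[symmetric] summable_ignore_initial_segment summable_ell1)
  also have "\<dots> < \<delta> / 4 + \<delta> / 4" by (intro add_strict_mono zb(1))
  finally show False using n by simp
qed

section \<open>Weak* continuous selections from the extension property\<close>

text \<open>A weak* continuous extension to \<open>\<ell>\<^sub>1\<close> of the restrictions to \<open>X\<close> of the functionals in the unit ball
  of \<open>\<ell>\<^sub>\<infinity>\<close>. The compact space \<open>K\<close> consists of these restrictions, extended by \<open>0\<close> off \<open>X\<close>, and not of the
  ball itself: this is what makes \<open>\<Phi> \<eta>\<close> depend only on the restriction of \<open>\<eta>\<close>.\<close>

lemma EP_selection:
  fixes X :: "ell1 set"
  assumes X: "subspace X" and EP: "has_EP X"
  obtains lam \<Phi> where "lam \<ge> 1"
    "\<And>\<eta>. \<eta> \<in> linf_ball 1 \<Longrightarrow> linear (\<Phi> \<eta>)"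
    "\<And>\<eta> z. \<eta> \<in> linf_ball 1 \<Longrightarrow> \<bar>\<Phi> \<eta> z\<bar> \<le> lam * norm z"
    "\<And>\<eta> x. \<eta> \<in> linf_ball 1 \<Longrightarrow> x \<in> X \<Longrightarrow> \<Phi> \<eta> x = pairing \<eta> x"
    "\<And>\<eta> \<eta>'. (\<And>x. x \<in> X \<Longrightarrow> pairing \<eta> x = pairing \<eta>' x) \<Longrightarrow> \<Phi> \<eta> = \<Phi> \<eta>'"
    "\<And>z. continuous_on (linf_ball 1) (\<lambda>\<eta>. \<Phi> \<eta> z)"
proof -
  obtain lam where lam: "lam \<ge> 1" "lambda_EP_over TYPE(ell1 \<Rightarrow> real) lam X"
    using EP unfolding has_EP_def lambda_EP_def by blast
  define \<psi> where "\<psi> \<eta> = (\<lambda>x. if x \<in> X then pairing \<eta> x else 0)" for \<eta>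
  define K where "K = top_of_set (\<psi> ` linf_ball 1)"
  have tK: "topspace K = \<psi> ` linf_ball 1" by (simp add: K_def)
  have \<psi>: "continuous_on (linf_ball 1) \<psi>"
  proof (rule continuous_on_coordinatewise_then_product)
    fix x show "continuous_on (linf_ball 1) (\<lambda>\<eta>. \<psi> \<eta> x)"
      by (cases "x \<in> X") (simp_all add: \<psi>_def continuous_on_pairing)
  qed
  have cK: "compact_space K"
    using compact_continuous_image[OF \<psi> compact_linf_ball] by (simp add: K_def compact_space_subtopology)
  have "Hausdorff_space (product_topology (\<lambda>_ :: ell1. euclideanreal) UNIV)"
    by (simp add: Hausdorff_space_product_topology)
  then have hK: "Hausdorff_space K"
    by (simp add: K_def Hausdorff_space_subtopology euclidean_product_topology)
  define T where "T x = restrict (\<lambda>\<phi>. \<phi> x) (topspace K)" for x :: ell1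
  have normT: "vnorm (C_space K) (T x) \<le> norm x" if "x \<in> X" for x
    unfolding C_space_def tK T_def using that abs_pairing_le[of _ 1 x]
    by (auto intro!: cSup_least simp: \<psi>_def)
  have contT: "continuous_map K euclideanreal (T x)" for x
  proof -
    have "continuous_on (topspace K) (\<lambda>\<phi>. \<phi> x)"
      by (intro continuous_on_product_coordinates continuous_on_subset[OF _ subset_UNIV])
    then have "continuous_on (topspace K) (T x)" by (rule continuous_on_eq) (simp add: T_def)
    then show ?thesis by (simp add: K_def)
  qed
  have addT: "T (x + y) = restrict (\<lambda>k. T x k + T y k) (topspace K)" if "x \<in> X" "y \<in> X" for x y
    using that subspace_add[OF X] linear_add[OF linear_pairing]
    by (auto simp: T_def tK \<psi>_def restrict_def fun_eq_iff)
  have scaleT: "T (c *\<^sub>R x) = restrict (\<lambda>k. c * T x k) (topspace K)" if "x \<in> X" for x c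
    using that subspace_scale[OF X] linear_scale[OF linear_pairing]
    by (auto simp: T_def tK \<psi>_def restrict_def fun_eq_iff)
  have "\<exists>M. \<forall>x\<in>X. vnorm (C_space K) (T x) \<le> M * norm x"
    using normT by (intro exI[of _ 1]) auto
  with contT addT scaleT have bT: "bounded_operator (nspace_on X) (C_space K) T"
    by (simp add: bounded_operator_def nspace_on_def C_space_def T_def)
  have opT: "operator_norm (nspace_on X) (C_space K) T \<le> 1"
    unfolding operator_norm_def using normT subspace_0[OF X]
    by (intro cSUP_least) (auto simp: nspace_on_def divide_le_eq_1 less_le_not_le)
  obtain S where S: "bounded_operator (nspace_on UNIV) (C_space K) S" "\<And>x. x \<in> X \<Longrightarrow> S x = T x"
      "operator_norm (nspace_on UNIV) (C_space K) S \<le> lam * operator_norm (nspace_on X) (C_space K) T"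
    using lam(2) cK hK bT unfolding lambda_EP_over_def by blast
  have contS: "continuous_on (\<psi> ` linf_ball 1) (S z)" for z
    using S(1) by (simp add: bounded_operator_def nspace_on_def C_space_def K_def)
  have normS: "\<bar>S z k\<bar> \<le> lam * norm z" if k: "k \<in> topspace K" for z k
  proof -
    obtain M where M: "\<And>x. vnorm (C_space K) (S x) \<le> M * norm x"
      using S(1) by (auto simp: bounded_operator_def nspace_on_def)
    have "compact (\<psi> ` linf_ball 1)" by (rule compact_continuous_image[OF \<psi> compact_linf_ball])
    then have "compact ((\<lambda>k. \<bar>S z k\<bar>) ` topspace K)"
      unfolding tK by (rule compact_continuous_image[OF continuous_on_rabs[OF contS]])
    then have bdd: "bdd_above ((\<lambda>k. \<bar>S z k\<bar>) ` topspace K)"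
      by (intro bounded_imp_bdd_above compact_imp_bounded)
    have le: "\<bar>S z k\<bar> \<le> vnorm (C_space K) (S z)"
      using k bdd by (auto simp: C_space_def intro!: cSup_upper)
    have "vnorm (C_space K) (S z) \<le> lam * norm z"
    proof (cases "z = 0")
      case True then show ?thesis using M[of z] by simp
    next
      case False
      have "vnorm (C_space K) (S x) / norm x \<le> max M 0" for x
      proof (cases "x = 0")
        case False
        then have "vnorm (C_space K) (S x) / norm x \<le> M" using M[of x] by (simp add: divide_le_eq)
        then show ?thesis by simp
      qed simp
      then have "vnorm (C_space K) (S z) / norm z \<le> operator_norm (nspace_on UNIV) (C_space K) S"
        unfolding operator_norm_def
        by (intro cSUP_upper2[where x = z] bdd_aboveI2[where M = "max M 0"]) (auto simp: nspace_on_def)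
      also have "\<dots> \<le> lam * 1" using S(3) opT lam(1) by (meson mult_left_mono order_trans zero_le_one)
      finally show ?thesis using False by (simp add: divide_simps)
    qed
    with le show ?thesis by simp
  qed
  show thesis
  proof (rule that[of lam "\<lambda>\<eta> z. S z (\<psi> \<eta>)"])
    show "lam \<ge> 1" by (rule lam(1))
  next
    fix \<eta> :: "nat \<Rightarrow> real" assume \<eta>: "\<eta> \<in> linf_ball 1"
    then show "linear (\<lambda>z. S z (\<psi> \<eta>))"
      using S(1) by (intro linearI) (auto simp: bounded_operator_def nspace_on_def C_space_def tK)
    show "\<bar>S z (\<psi> \<eta>)\<bar> \<le> lam * norm z" for z using \<eta> by (intro normS) (simp add: tK)
    show "S x (\<psi> \<eta>) = pairing \<eta> x" if "x \<in> X" for x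
      using S(2)[OF that] \<eta> that by (simp add: T_def tK \<psi>_def)
  next
    fix \<eta> \<eta>' assume "\<And>x. x \<in> X \<Longrightarrow> pairing \<eta> x = pairing \<eta>' x"
    then have "\<psi> \<eta> = \<psi> \<eta>'" by (auto simp: \<psi>_def)
    then show "(\<lambda>z. S z (\<psi> \<eta>)) = (\<lambda>z. S z (\<psi> \<eta>'))" by simp
  next
    fix z show "continuous_on (linf_ball 1) (\<lambda>\<eta>. S z (\<psi> \<eta>))"
      by (rule continuous_on_compose2[OF contS \<psi>]) simp
  qed
qed

text \<open>The difference \<open>\<Psi> \<eta> = \<eta> - \<Phi> \<eta>\<close>. As \<open>\<Phi> \<eta>\<close> only sees the restriction of \<open>\<eta>\<close> to \<open>X\<close>, adding an
  annihilator \<open>\<xi>\<close> of \<open>X\<close> to \<open>\<eta>\<close> adds \<open>\<xi>\<close> to \<open>\<Psi> \<eta>\<close>.\<close>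

lemma EP_annihilator_selection:
  fixes X :: "ell1 set"
  assumes X: "subspace X" and EP: "has_EP X"
  obtains C \<Psi> where "C > 0"
    "\<And>\<eta>. \<eta> \<in> linf_ball 1 \<Longrightarrow> linear (\<Psi> \<eta>)"
    "\<And>\<eta> z. \<eta> \<in> linf_ball 1 \<Longrightarrow> \<bar>\<Psi> \<eta> z\<bar> \<le> C * norm z"
    "\<And>\<eta> x. \<eta> \<in> linf_ball 1 \<Longrightarrow> x \<in> X \<Longrightarrow> \<Psi> \<eta> x = 0"
    "\<And>z. continuous_on (linf_ball 1) (\<lambda>\<eta>. \<Psi> \<eta> z)"
    "\<And>\<eta> \<xi> z. \<eta> \<in> linf_ball 1 \<Longrightarrow> \<xi> \<in> linf_ball 1 \<Longrightarrow> (\<And>x. x \<in> X \<Longrightarrow> pairing \<xi> x = 0) \<Longrightarrow>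
       \<Psi> (\<lambda>i. \<eta> i + \<xi> i) z = \<Psi> \<eta> z + pairing \<xi> z"
proof -
  obtain lam \<Phi> where lam: "lam \<ge> 1"
    and lin: "\<And>\<eta>. \<eta> \<in> linf_ball 1 \<Longrightarrow> linear (\<Phi> \<eta>)"
    and bd: "\<And>\<eta> z. \<eta> \<in> linf_ball 1 \<Longrightarrow> \<bar>\<Phi> \<eta> z\<bar> \<le> lam * norm z"
    and ext: "\<And>\<eta> x. \<eta> \<in> linf_ball 1 \<Longrightarrow> x \<in> X \<Longrightarrow> \<Phi> \<eta> x = pairing \<eta> x"
    and dep: "\<And>\<eta> \<eta>'. (\<And>x. x \<in> X \<Longrightarrow> pairing \<eta> x = pairing \<eta>' x) \<Longrightarrow> \<Phi> \<eta> = \<Phi> \<eta>'"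
    and cont: "\<And>z. continuous_on (linf_ball 1) (\<lambda>\<eta>. \<Phi> \<eta> z)"
    using EP_selection[OF X EP] by blast
  show thesis
  proof (rule that[of "1 + lam" "\<lambda>\<eta> z. pairing \<eta> z - \<Phi> \<eta> z"])
    show "1 + lam > 0" using lam by simp
  next
    fix \<eta> :: "nat \<Rightarrow> real" assume \<eta>: "\<eta> \<in> linf_ball 1"
    show "linear (\<lambda>z. pairing \<eta> z - \<Phi> \<eta> z)"
      by (rule linear_compose_sub[OF linear_pairing[OF \<eta>] lin[OF \<eta>]])
    show "\<bar>pairing \<eta> z - \<Phi> \<eta> z\<bar> \<le> (1 + lam) * norm z" for z
      using abs_pairing_le[OF \<eta>, of z] bd[OF \<eta>, of z] by (simp add: distrib_right)
    show "pairing \<eta> x - \<Phi> \<eta> x = 0" if "x \<in> X" for x using ext[OF \<eta> that] by simp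
  next
    fix z show "continuous_on (linf_ball 1) (\<lambda>\<eta>. pairing \<eta> z - \<Phi> \<eta> z)"
      by (intro continuous_on_diff continuous_on_pairing cont)
  next
    fix \<eta> \<xi> :: "nat \<Rightarrow> real" and z
    assume \<eta>: "\<eta> \<in> linf_ball 1" and \<xi>: "\<xi> \<in> linf_ball 1" and "\<And>x. x \<in> X \<Longrightarrow> pairing \<xi> x = 0"
    then have "\<Phi> (\<lambda>i. \<eta> i + \<xi> i) = \<Phi> \<eta>"
      by (intro dep) (simp add: pairing_add[OF \<eta> \<xi>])
    then show "pairing (\<lambda>i. \<eta> i + \<xi> i) z - \<Phi> (\<lambda>i. \<eta> i + \<xi> i) z
        = pairing \<eta> z - \<Phi> \<eta> z + pairing \<xi> z"
      by (simp add: pairing_add[OF \<eta> \<xi>])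
  qed
qed

section \<open>One step along the tree\<close>

text \<open>Arbitrarily weak* close to any \<open>\<eta>\<close> in the unit ball there is an \<open>\<eta>'\<close>, still in the ball, for which
  \<open>\<Psi> \<eta>'\<close> is large at some member of a given infinite separated family.\<close>

lemma nearby_large_value:
  fixes \<Psi> :: "(nat \<Rightarrow> real) \<Rightarrow> ell1 \<Rightarrow> real"
  assumes X: "subspace X"
    and shift: "\<And>\<eta> \<xi> z. \<eta> \<in> linf_ball 1 \<Longrightarrow> \<xi> \<in> linf_ball 1 \<Longrightarrow> (\<And>x. x \<in> X \<Longrightarrow> pairing \<xi> x = 0) \<Longrightarrow>
       \<Psi> (\<lambda>i. \<eta> i + \<xi> i) z = \<Psi> \<eta> z + pairing \<xi> z"
    and B: "infinite B" and \<delta>: "\<delta> > 0"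
    and sep: "\<And>b b'. b \<in> B \<Longrightarrow> b' \<in> B \<Longrightarrow> b \<noteq> b' \<Longrightarrow> infdist (u b - u b') X \<ge> \<delta>"
    and \<eta>: "\<eta> \<in> linf_ball 1" "open U" "\<eta> \<in> U"
  shows "\<exists>\<eta>'\<in>linf_ball 1 \<inter> U. \<exists>b\<in>B. \<bar>\<Psi> \<eta>' (u b)\<bar> \<ge> \<delta> / 8"
proof -
  define \<epsilon> where "\<epsilon> N = inverse (real (Suc N))" for N
  have \<epsilon>: "0 < \<epsilon> N" "\<epsilon> N \<le> 1" for N
    by (auto simp: \<epsilon>_def inverse_le_1_iff)
  define w where "w N = (\<lambda>i. if i < N then \<epsilon> N else 1)" for N
  have w: "w N \<in> linf_ball 1" "w N i \<ge> 0" for N i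
    using \<epsilon>[of N] by (auto simp: w_def linf_ball_def)
  have "\<exists>\<xi> b. b \<in> B \<and> (\<forall>i. \<bar>\<xi> i\<bar> \<le> w N i) \<and> (\<forall>x\<in>X. pairing \<xi> x = 0) \<and> pairing \<xi> (u b) \<ge> \<delta> / 4" for N
  proof -
    have "\<exists>b\<in>B. (INF x\<in>X. wnorm (w N) (u b - x)) \<ge> \<delta> / 4"
      unfolding w_def by (rule separated_imp_large_wnorm[where u = u, OF X B \<delta> sep \<epsilon>])
    then obtain b where b: "b \<in> B" "(INF x\<in>X. wnorm (w N) (u b - x)) \<ge> \<delta> / 4"
      by blast
    obtain \<xi> where "\<And>i. \<bar>\<xi> i\<bar> \<le> w N i" "\<And>x. x \<in> X \<Longrightarrow> pairing \<xi> x = 0"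
      "pairing \<xi> (u b) = (INF x\<in>X. wnorm (w N) (u b - x))"
      using annihilator_attaining[OF X w(1)[of N] w(2)[of N], of "u b"] by blast
    with b show ?thesis by (intro exI[of _ \<xi>] exI[of _ b]) auto
  qed
  then obtain \<xi> b where b: "\<And>N. b N \<in> B" and \<xi>: "\<And>N i. \<bar>\<xi> N i\<bar> \<le> w N i"
    and ann: "\<And>N x. x \<in> X \<Longrightarrow> pairing (\<xi> N) x = 0" and large: "\<And>N. pairing (\<xi> N) (u (b N)) \<ge> \<delta> / 4"
    by metis
  \<comment> \<open>The factor \<open>1 - \<epsilon> N\<close> leaves room for adding \<open>\<xi> N\<close>, whose first \<open>N\<close> coordinates are at most \<open>\<epsilon> N\<close>; the
    other coordinates are cut off, because there \<open>\<xi> N\<close> may have modulus \<open>1\<close>.\<close>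
  define \<theta> where "\<theta> N i = (if i < N then (1 - \<epsilon> N) * \<eta> i else 0)" for N i
  have \<theta>w: "\<bar>\<theta> N i\<bar> \<le> 1 - w N i" for N i
    using \<eta>(1) \<epsilon>[of N] by (auto simp: \<theta>_def w_def linf_ball_def abs_mult intro: mult_right_le_one_le)
  have \<theta>linf_ball: "\<theta> N \<in> linf_ball 1" for N
  proof -
    have "\<bar>\<theta> N i\<bar> \<le> 1" for i using \<theta>w[of N i] w(2)[of N i] by linarith
    then show ?thesis by (simp add: linf_ball_def)
  qed
  have \<xi>linf_ball: "\<xi> N \<in> linf_ball 1" for N
  proof -
    have "\<bar>\<xi> N i\<bar> \<le> 1" for i using \<xi>[of N i] \<theta>w[of N i] by linarith
    then show ?thesis by (simp add: linf_ball_def)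
  qed
  have sbox: "(\<lambda>i. \<theta> N i + \<xi> N i) \<in> linf_ball 1" for N
  proof -
    have "\<bar>\<theta> N i + \<xi> N i\<bar> \<le> 1" for i
      using abs_triangle_ineq[of "\<theta> N i" "\<xi> N i"] \<theta>w[of N i] \<xi>[of N i] by linarith
    then show ?thesis by (simp add: linf_ball_def)
  qed
  have \<epsilon>0: "\<epsilon> \<longlonglongrightarrow> 0" unfolding \<epsilon>_def by (rule LIMSEQ_inverse_real_of_nat)
  have \<theta>lim: "(\<lambda>N. \<theta> N i) \<longlonglongrightarrow> \<eta> i" for i
  proof (rule Lim_transform_eventually)
    show "(\<lambda>N. (1 - \<epsilon> N) * \<eta> i) \<longlonglongrightarrow> \<eta> i"
      using tendsto_mult[OF tendsto_diff[OF tendsto_const[of 1] \<epsilon>0] tendsto_const[of "\<eta> i"]] by simp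
    show "\<forall>\<^sub>F N in sequentially. (1 - \<epsilon> N) * \<eta> i = \<theta> N i"
      using eventually_gt_at_top[of i] by eventually_elim (simp add: \<theta>_def)
  qed
  have "(\<lambda>N. \<xi> N i) \<longlonglongrightarrow> 0" for i
  proof (rule Lim_null_comparison[OF _ \<epsilon>0])
    show "\<forall>\<^sub>F N in sequentially. norm (\<xi> N i) \<le> \<epsilon> N"
      using eventually_gt_at_top[of i]
    proof eventually_elim
      case (elim N) then show ?case using \<xi>[of N i] by (simp add: w_def)
    qed
  qed
  from tendsto_add[OF \<theta>lim this] have "(\<lambda>N. \<theta> N i + \<xi> N i) \<longlonglongrightarrow> \<eta> i" for i
    by simp
  with \<theta>lim have "\<theta> \<longlonglongrightarrow> \<eta>" "(\<lambda>N i. \<theta> N i + \<xi> N i) \<longlonglongrightarrow> \<eta>"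
    by (simp_all add: tendsto_funI)
  then have "\<forall>\<^sub>F N in sequentially. \<theta> N \<in> U \<and> (\<lambda>i. \<theta> N i + \<xi> N i) \<in> U"
    by (intro eventually_conj topological_tendstoD[OF _ \<eta>(2,3)])
  then obtain N where N: "\<theta> N \<in> U" "(\<lambda>i. \<theta> N i + \<xi> N i) \<in> U"
    by (auto simp: eventually_sequentially)
  have "\<Psi> (\<lambda>i. \<theta> N i + \<xi> N i) (u (b N)) = \<Psi> (\<theta> N) (u (b N)) + pairing (\<xi> N) (u (b N))"
    by (intro shift \<theta>linf_ball \<xi>linf_ball ann)
  then have "\<bar>\<Psi> (\<theta> N) (u (b N))\<bar> \<ge> \<delta> / 8 \<or> \<bar>\<Psi> (\<lambda>i. \<theta> N i + \<xi> N i) (u (b N))\<bar> \<ge> \<delta> / 8"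
    using large[of N] by linarith
  then show ?thesis using N \<theta>linf_ball sbox b by blast
qed

section \<open>The very strong Schur property\<close>

lemma dual_ball_quotientI:
  fixes g :: "'a::real_normed_vector \<Rightarrow> real"
  assumes X: "subspace X" and g: "linear g" "\<And>z. \<bar>g z\<bar> \<le> norm z" "\<And>x. x \<in> X \<Longrightarrow> g x = 0"
  shows "\<exists>f\<in>dual_ball (quotient_nspace X). \<forall>z. f (coset X z) = g z"
proof -
  define f where "f A = g (SOME z. z \<in> A)" for A
  have f: "f (coset X z) = g z" for z
  proof -
    have "z + 0 \<in> coset X z" unfolding coset_def using subspace_0[OF X] by blast
    then have "(SOME z'. z' \<in> coset X z) \<in> coset X z" by (rule someI)
    then show ?thesis by (auto simp: f_def coset_def linear_add[OF g(1)] g(3))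
  qed
  have carrier: "vcarrier (quotient_nspace X) = range (coset X)" by (simp add: quotient_nspace_def)
  have bound: "\<bar>f (coset X z)\<bar> \<le> infdist z X" for z
  proof -
    have "\<bar>g z\<bar> \<le> dist z x" if "x \<in> X" for x
      using g(2)[of "z - x"] g(3)[OF that] by (simp add: dist_norm linear_diff[OF g(1)])
    then show ?thesis
      using subspace_0[OF X] by (auto simp: f infdist_def intro!: cINF_greatest)
  qed
  have "bounded_operator (quotient_nspace X) (nspace_on UNIV) f"
    unfolding bounded_operator_def carrier
    using bound by (auto simp: nspace_on_def vadd_quotient_coset[OF X] vscale_quotient_coset[OF X]
        vnorm_quotient_coset[OF X] f linear_add[OF g(1)] linear_scale[OF g(1)] intro!: exI[of _ 1])
  moreover have "operator_norm (quotient_nspace X) (nspace_on UNIV) f \<le> 1"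
    unfolding operator_norm_def carrier
    using bound by (intro cSUP_least) (auto simp: nspace_on_def vnorm_quotient_coset[OF X]
        divide_le_eq_1 less_le infdist_nonneg)
  ultimately show ?thesis using f by (intro bexI[of _ f]) (auto simp: dual_ball_def)
qed

theorem theorem5p1:
  fixes X :: "ell1 set"
  assumes "subspace X" and "closed X" and "has_EP X"
  shows "very_strong_Schur (quotient_nspace X)"
proof -
  note X = \<open>subspace X\<close>
  let ?Y = "quotient_nspace X"
  obtain C \<Psi> where C: "C > 0"
    and lin: "\<And>\<eta>. \<eta> \<in> linf_ball 1 \<Longrightarrow> linear (\<Psi> \<eta>)"
    and bd: "\<And>\<eta> z. \<eta> \<in> linf_ball 1 \<Longrightarrow> \<bar>\<Psi> \<eta> z\<bar> \<le> C * norm z"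
    and ann: "\<And>\<eta> x. \<eta> \<in> linf_ball 1 \<Longrightarrow> x \<in> X \<Longrightarrow> \<Psi> \<eta> x = 0"
    and cont: "\<And>z. continuous_on (linf_ball 1) (\<lambda>\<eta>. \<Psi> \<eta> z)"
    and shift: "\<And>\<eta> \<xi> z. \<eta> \<in> linf_ball 1 \<Longrightarrow> \<xi> \<in> linf_ball 1 \<Longrightarrow> (\<And>x. x \<in> X \<Longrightarrow> pairing \<xi> x = 0) \<Longrightarrow>
       \<Psi> (\<lambda>i. \<eta> i + \<xi> i) z = \<Psi> \<eta> z + pairing \<xi> z"
    using EP_annihilator_selection[OF X \<open>has_EP X\<close>] by blast
  have "\<exists>\<beta> f. branch S \<beta> \<and> f \<in> dual_ball ?Y \<and> (\<forall>a\<in>range \<beta>. a \<noteq> {} \<longrightarrow> \<bar>f (x a)\<bar> \<ge> 1 / (9 * C) * \<delta>)"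
    if \<delta>: "\<delta> > 0" and tree: "tree_assignment ?Y S x" and sep: "tree_separated ?Y S x \<delta>" for \<delta> S x
  proof -
    have S: "full_tree S" using tree by (simp add: tree_assignment_def)
    have "\<exists>z. x a = coset X z" if "a \<in> S" for a
      using tree that by (auto simp: tree_assignment_def quotient_nspace_def)
    then obtain u where u: "\<And>a. a \<in> S \<Longrightarrow> x a = coset X (u a)" by metis
    have sepu: "infdist (u b - u b') X \<ge> \<delta>"
      if "a \<in> S" "b \<in> S \<inter> successors a" "b' \<in> S \<inter> successors a" "b \<noteq> b'" for a b b'
    proof -
      have "vdist ?Y (x b) (x b') \<ge> \<delta>" using sep that unfolding tree_separated_def by blast
      then show ?thesis using that
        by (simp add: u vdist_def vadd_quotient_coset[OF X] vscale_quotient_coset[OF X]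
            vnorm_quotient_coset[OF X])
    qed
    \<comment> \<open>A state after \<open>n\<close> steps consists of a point of the ball, the current node, and a neighbourhood of the point
      on which the estimate at that node holds; at the root, where \<open>n = 0\<close>, there is none. The neighbourhoods decrease, so that all later points satisfy
      the estimates at all earlier nodes.\<close>
    define good where "good n s \<longleftrightarrow> (case s of (\<eta>, U, a) \<Rightarrow>
      \<eta> \<in> linf_ball 1 \<and> open U \<and> \<eta> \<in> U \<and> a \<in> S \<and> (n = 0 \<longrightarrow> a = {}) \<and>
      (n > 0 \<longrightarrow> (\<forall>\<eta>'\<in>linf_ball 1 \<inter> U. \<bar>\<Psi> \<eta>' (u a)\<bar> > \<delta> / 9)))" for n :: nat and s
    define next_state where "next_state s s' \<longleftrightarrow> (case s of (\<eta>, U, a) \<Rightarrow> case s' of (\<eta>', U', a') \<Rightarrow>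
      U' \<subseteq> U \<and> a' \<in> successors a)" for s s' :: "(nat \<Rightarrow> real) \<times> (nat \<Rightarrow> real) set \<times> nat set"
    have "\<exists>\<sigma>. \<forall>n. good n (\<sigma> n) \<and> next_state (\<sigma> n) (\<sigma> (Suc n))"
    proof (rule dependent_nat_choice)
      have "good 0 (\<lambda>_. 0, UNIV, {})"
        using S by (simp add: good_def linf_ball_def full_tree_def)
      then show "\<exists>s. good 0 s" by blast
    next
      fix s n assume "good n s"
      then obtain \<eta> U a where s: "s = (\<eta>, U, a)" and \<eta>: "\<eta> \<in> linf_ball 1" "open U" "\<eta> \<in> U" and a: "a \<in> S"
        by (cases s) (auto simp: good_def)
      have inf: "infinite (S \<inter> successors a)" using S a by (auto simp: full_tree_def Int_commute)
      have "\<exists>\<eta>'\<in>linf_ball 1 \<inter> U. \<exists>b\<in>S \<inter> successors a. \<bar>\<Psi> \<eta>' (u b)\<bar> \<ge> \<delta> / 8"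
        by (rule nearby_large_value[OF X shift inf \<delta> sepu[OF a] \<eta>])
      then obtain \<eta>' b where \<eta>': "\<eta>' \<in> linf_ball 1" "\<eta>' \<in> U" and b: "b \<in> S" "b \<in> successors a"
        and large: "\<bar>\<Psi> \<eta>' (u b)\<bar> \<ge> \<delta> / 8"
        by blast
      have "continuous_on (linf_ball 1) (\<lambda>\<eta>. \<bar>\<Psi> \<eta> (u b)\<bar>)"
        by (intro continuous_on_rabs cont)
      then obtain V where V: "open V" "V \<inter> linf_ball 1 = (\<lambda>\<eta>. \<bar>\<Psi> \<eta> (u b)\<bar>) -` {\<delta> / 9<..} \<inter> linf_ball 1"
        unfolding continuous_on_open_invariant using open_greaterThan by blast
      have "\<eta>' \<in> V" using V(2) \<eta>'(1) large \<delta> by auto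
      then have "good (Suc n) (\<eta>', U \<inter> V, b) \<and> next_state s (\<eta>', U \<inter> V, b)"
        using \<eta>' b \<eta>(2) V by (auto simp: good_def next_state_def s)
      then show "\<exists>s'. good (Suc n) s' \<and> next_state s s'" by blast
    qed
    then obtain \<sigma> where \<sigma>: "\<And>n. good n (\<sigma> n)" "\<And>n. next_state (\<sigma> n) (\<sigma> (Suc n))" by blast
    define \<eta> where "\<eta> n = fst (\<sigma> n)" for n
    define U where "U n = fst (snd (\<sigma> n))" for n
    define \<beta> where "\<beta> n = snd (snd (\<sigma> n))" for n
    have st: "\<sigma> n = (\<eta> n, U n, \<beta> n)" for n by (simp add: \<eta>_def U_def \<beta>_def)
    have \<eta>: "\<eta> n \<in> linf_ball 1" "\<eta> n \<in> U n" "\<beta> n \<in> S" "\<beta> 0 = {}"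
      and Ularge: "\<And>\<eta>'. n > 0 \<Longrightarrow> \<eta>' \<in> linf_ball 1 \<Longrightarrow> \<eta>' \<in> U n \<Longrightarrow> \<bar>\<Psi> \<eta>' (u (\<beta> n))\<bar> > \<delta> / 9" for n
      using \<sigma>(1)[of n] \<sigma>(1)[of 0] by (auto simp: good_def st)
    have nxt: "U (Suc n) \<subseteq> U n" "\<beta> (Suc n) \<in> successors (\<beta> n)" for n
      using \<sigma>(2)[of n] by (auto simp: next_state_def st)
    have "branch S \<beta>" using \<eta> nxt by (auto simp: branch_def)
    have "decseq U" using nxt(1) by (simp add: decseq_Suc_iff)
    obtain \<zeta> r where \<zeta>: "\<zeta> \<in> linf_ball 1" and r: "strict_mono r" "(\<eta> \<circ> r) \<longlonglongrightarrow> \<zeta>"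
      using linf_ball_convergent_subseq[of \<eta>, OF \<eta>(1)] by blast
    have limit: "\<bar>\<Psi> \<zeta> (u (\<beta> n))\<bar> \<ge> \<delta> / 9" if "n > 0" for n
    proof (rule tendsto_lowerbound)
      have "(\<lambda>m. \<Psi> ((\<eta> \<circ> r) m) (u (\<beta> n))) \<longlonglongrightarrow> \<Psi> \<zeta> (u (\<beta> n))"
        by (rule continuous_on_tendsto_compose[OF cont r(2) \<zeta>]) (simp add: \<eta>(1))
      then show "(\<lambda>m. \<bar>\<Psi> ((\<eta> \<circ> r) m) (u (\<beta> n))\<bar>) \<longlonglongrightarrow> \<bar>\<Psi> \<zeta> (u (\<beta> n))\<bar>"
        by (rule tendsto_rabs)
      have "\<delta> / 9 \<le> \<bar>\<Psi> ((\<eta> \<circ> r) m) (u (\<beta> n))\<bar>" if "m \<ge> n" for m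
      proof -
        have "n \<le> r m" using that strict_mono_imp_increasing[OF r(1), of m] by simp
        then have "\<eta> (r m) \<in> U n" using \<eta>(2)[of "r m"] decseqD[OF \<open>decseq U\<close>] by blast
        then show ?thesis using Ularge[OF \<open>n > 0\<close> \<eta>(1)] by (simp add: less_imp_le)
      qed
      then show "\<forall>\<^sub>F m in sequentially. \<delta> / 9 \<le> \<bar>\<Psi> ((\<eta> \<circ> r) m) (u (\<beta> n))\<bar>"
        by (auto simp: eventually_sequentially)
    qed simp
    have "linear (\<lambda>z. \<Psi> \<zeta> z / C)"
      using lin[OF \<zeta>] by (intro linearI) (auto simp: linear_add linear_scale add_divide_distrib)
    moreover have "\<bar>\<Psi> \<zeta> z / C\<bar> \<le> norm z" for z
      using bd[OF \<zeta>, of z] C by (simp add: abs_div pos_divide_le_eq mult.commute)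
    moreover have "\<Psi> \<zeta> x / C = 0" if "x \<in> X" for x using ann[OF \<zeta> that] by simp
    ultimately have "\<exists>f\<in>dual_ball ?Y. \<forall>z. f (coset X z) = \<Psi> \<zeta> z / C"
      by (rule dual_ball_quotientI[OF X, where g = "\<lambda>z. \<Psi> \<zeta> z / C"])
    then obtain f where f: "f \<in> dual_ball ?Y" and fz: "\<forall>z. f (coset X z) = \<Psi> \<zeta> z / C"
      by (rule bexE)
    have "\<bar>f (x a)\<bar> \<ge> 1 / (9 * C) * \<delta>" if a: "a \<in> range \<beta>" "a \<noteq> {}" for a
    proof -
      obtain n where n: "a = \<beta> n" using a(1) by blast
      then have "n > 0" using a(2) \<eta>(4) by (cases "n = 0") simp_all
      have "\<bar>f (x a)\<bar> = \<bar>\<Psi> \<zeta> (u (\<beta> n))\<bar> / C" using \<eta>(3) C by (simp add: n u fz)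
      then show ?thesis using limit[OF \<open>n > 0\<close>] C by (simp add: field_simps)
    qed
    then show ?thesis using \<open>branch S \<beta>\<close> f by blast
  qed
  moreover have "1 / (9 * C) > 0" using C by simp
  ultimately show ?thesis unfolding very_strong_Schur_def by blast
qed

end
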